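(* Let $A$ and $B$ be connected graded $k$-algebras finitely generated in degree $1$, and suppose that $Z(A)\cap A_1=\{0\}$. If $A[t_1,\dots,t_n]\cong B[s_1,\dots,s_n]$ as ungraded algebras, then $A\cong B$.
   Context: $Z(A)$ denotes the center of $A$. $A[t_1,\dots,t_n]$ and $B[s_1,\dots,s_n]$ are polynomial extensions in central indeterminates. A connected graded algebra satisfies $A_0=k$; finitely generated in degree $1$ means $\dim_k A_1<\infty$ and $A$ is generated by $A_1$. *)

theory Defs
  imports Main "HOL-Library.Poly_Mapping"
begin

definition algebra_str :: "('k::field \<Rightarrow> 'a::ring_1) \<Rightarrow> bool" where
  "algebra_str \<iota> \<longleftrightarrow>
     (\<forall>a b. \<iota> (a + b) = \<iota> a + \<iota> b) \<and> (\<forall>a b. \<iota> (a * b) = \<iota> a * \<iota> b) \<and> \<iota> 1 = 1 \<and>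
     (\<forall>c x. \<iota> c * x = x * \<iota> c)"

definition k_span :: "('k::field \<Rightarrow> 'a::ring_1) \<Rightarrow> 'a set \<Rightarrow> 'a set" where
  "k_span \<iota> S = {(\<Sum>s\<in>F. \<iota> (c s) * s) | F c. finite F \<and> F \<subseteq> S}"

inductive_set gen_alg :: "('k::field \<Rightarrow> 'a::ring_1) \<Rightarrow> 'a set \<Rightarrow> 'a set"
  for \<iota> :: "'k \<Rightarrow> 'a" and S :: "'a set" where
  gen: "s \<in> S \<Longrightarrow> s \<in> gen_alg \<iota> S"
| scal: "\<iota> c \<in> gen_alg \<iota> S"
| add: "x \<in> gen_alg \<iota> S \<Longrightarrow> y \<in> gen_alg \<iota> S \<Longrightarrow> x + y \<in> gen_alg \<iota> S"
| mult: "x \<in> gen_alg \<iota> S \<Longrightarrow> y \<in> gen_alg \<iota> S \<Longrightarrow> x * y \<in> gen_alg \<iota> S"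

definition conn_graded_fg1 :: "('k::field \<Rightarrow> 'a::ring_1) \<Rightarrow> (nat \<Rightarrow> 'a set) \<Rightarrow> bool" where
  "conn_graded_fg1 \<iota> gr \<longleftrightarrow>
     algebra_str \<iota> \<and>
     (\<forall>i. 0 \<in> gr i \<and> (\<forall>x\<in>gr i. \<forall>y\<in>gr i. x + y \<in> gr i) \<and> (\<forall>c. \<forall>x\<in>gr i. \<iota> c * x \<in> gr i)) \<and>
     (\<forall>i j. \<forall>x\<in>gr i. \<forall>y\<in>gr j. x * y \<in> gr (i + j)) \<and>
     (\<forall>x. \<exists>!h. (\<forall>i. h i \<in> gr i) \<and> finite {i. h i \<noteq> 0} \<and> x = sum h {i. h i \<noteq> 0}) \<and>
     gr 0 = range \<iota> \<and>
     (\<exists>S. finite S \<and> S \<subseteq> gr 1 \<and> gr 1 = k_span \<iota> S) \<and>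
     gen_alg \<iota> (gr 1) = UNIV"

text \<open>Polynomial ring A[t_1..t_n] in central indeterminates indexed by the finite
  type 'n is the ring of finitely supported maps from monomials to A; its k-algebra structure map:\<close>
definition poly_iota :: "('k::field \<Rightarrow> 'a::ring_1) \<Rightarrow> 'k \<Rightarrow> (('n \<Rightarrow>\<^sub>0 nat) \<Rightarrow>\<^sub>0 'a)" where
  "poly_iota \<iota> c = Poly_Mapping.single 0 (\<iota> c)"

definition alg_iso :: "('k::field \<Rightarrow> 'a::ring_1) \<Rightarrow> ('k \<Rightarrow> 'b::ring_1) \<Rightarrow> ('a \<Rightarrow> 'b) \<Rightarrow> bool" where
  "alg_iso \<iota>A \<iota>B f \<longleftrightarrow> bij f \<and> (\<forall>x y. f (x + y) = f x + f y) \<and> (\<forall>x y. f (x * y) = f x * f y) \<and>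
     f 1 = 1 \<and> (\<forall>c. f (\<iota>A c) = \<iota>B c)"

end

theory Submission
  imports Defs "HOL.Vector_Spaces"
begin

text \<open>Let \<open>R\<close> and \<open>S\<close> be connected graded algebras generated in degree 1, with degree filtrations
  \<open>low\<close> (increasing) and \<open>high\<close> (decreasing), and let \<open>f: R \<rightarrow> S\<close> be an ungraded isomorphism. Then
  \<open>R = R.low d + f\<inverse>(S.high (d+1))\<close>, so truncation gives surjections between \<open>R.low d\<close> and \<open>S.low d\<close> in both
  directions; as these spaces are finite-dimensional, the sum is direct. Hence each \<open>s\<close> homogeneous of
  degree \<open>d\<close> is the leading part of \<open>f w\<close> for a unique \<open>w\<close> in \<open>R.low d\<close>, and \<open>s \<mapsto> w\<close> extends to an isomorphism
  \<open>G: S \<rightarrow> R\<close> that respects the increasing filtration.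

  For \<open>R = A[t]\<close> and \<open>S = B[s]\<close> each \<open>G s\<^sub>i\<close> is central in \<open>R.low 1\<close>, so by the hypothesis on the center it lies in
  the span of \<open>1\<close> and the \<open>t\<^sub>j\<close>; by dimension \<open>G\<close> identifies the two affine spans. Hence \<open>G\<close> maps the ideal
  \<open>(s)\<close> onto \<open>(t - d)\<close> for some scalars \<open>d\<close>, and \<open>A = R/(t - d) \<cong> S/(s) = B\<close>.\<close>

subsection \<open>Connected graded algebras\<close>

locale central_algebra =
  fixes \<iota> :: "'k::field \<Rightarrow> 'a::ring_1"
  assumes algebra: "algebra_str \<iota>"
begin

lemma iota_add: "\<iota> (a + b) = \<iota> a + \<iota> b"
  and iota_mult: "\<iota> (a * b) = \<iota> a * \<iota> b"
  and iota_one [simp]: "\<iota> 1 = 1"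
  and iota_central: "\<iota> c * x = x * \<iota> c"
  using algebra unfolding algebra_str_def by blast+

lemma iota_zero [simp]: "\<iota> 0 = 0"
  using iota_add[of 0 0] by simp

lemma iota_left_commute: "x * (\<iota> c * y) = \<iota> c * (x * y)"
  by (metis iota_central mult.assoc)

sublocale vs: vector_space "\<lambda>c x. \<iota> c * x"
  by unfold_locales (simp_all add: distrib_left distrib_right iota_add iota_mult mult.assoc)

lemma k_span_eq_span: "k_span \<iota> S = vs.span S"
  unfolding k_span_def vs.span_explicit by (rule Collect_cong) blast

text \<open>Bilinearity, one factor at a time: span induction on \<open>x\<close>, then on
  \<open>y\<close> with a fixed generator \<open>u\<close>. In particular a set closed under
  products has a span closed under products.\<close>

lemma mult_span:
  assumes "x \<in> vs.span X" "y \<in> vs.span Y"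
  shows "x * y \<in> vs.span {u * v | u v. u \<in> X \<and> v \<in> Y}"
  using assms(1)
proof (induction rule: vs.span_induct)
  case base
  show ?case
    by (rule vs.subspaceI)
       (auto simp: distrib_right mult.assoc intro: vs.span_zero vs.span_add vs.span_scale)
next
  case (step u)
  show ?case using assms(2)
  proof (induction rule: vs.span_induct)
    case base
    show ?case
      by (rule vs.subspaceI)
         (auto simp: distrib_left iota_left_commute intro: vs.span_zero vs.span_add vs.span_scale)
  next
    case (step v)
    then show ?case using \<open>u \<in> X\<close> by (auto intro!: vs.span_base)
  qed
qed

end

locale conn_graded =
  fixes \<iota> :: "'k::field \<Rightarrow> 'a::ring_1" and gr :: "nat \<Rightarrow> 'a set"
  assumes conn_graded: "conn_graded_fg1 \<iota> gr"

sublocale conn_graded \<subseteq> central_algebra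
  using conn_graded unfolding conn_graded_fg1_def by unfold_locales blast

context conn_graded
begin

lemma gr_zero: "0 \<in> gr i"
  and gr_add: "x \<in> gr i \<Longrightarrow> y \<in> gr i \<Longrightarrow> x + y \<in> gr i"
  and gr_scale: "x \<in> gr i \<Longrightarrow> \<iota> c * x \<in> gr i"
  and gr_mult: "x \<in> gr i \<Longrightarrow> y \<in> gr j \<Longrightarrow> x * y \<in> gr (i + j)"
  and gr_0: "gr 0 = range \<iota>"
  and generated: "gen_alg \<iota> (gr 1) = UNIV"
  and fin_span: "\<exists>S. finite S \<and> S \<subseteq> gr 1 \<and> gr 1 = vs.span S"
  and ex1_decomp: "\<exists>!h. (\<forall>i. h i \<in> gr i) \<and> finite {i. h i \<noteq> 0} \<and> x = sum h {i. h i \<noteq> 0}"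
  using conn_graded unfolding conn_graded_fg1_def k_span_eq_span by blast+

section \<open>Homogeneous components\<close>

definition hpart :: "nat \<Rightarrow> 'a \<Rightarrow> 'a" where
  "hpart i x = (THE h. (\<forall>i. h i \<in> gr i) \<and> finite {i. h i \<noteq> 0} \<and> x = sum h {i. h i \<noteq> 0}) i"

lemma hpart_props:
  "(\<forall>i. hpart i x \<in> gr i) \<and> finite {i. hpart i x \<noteq> 0} \<and> x = (\<Sum>i | hpart i x \<noteq> 0. hpart i x)"
  using theI'[OF ex1_decomp[of x]] unfolding hpart_def by simp

lemma hpart_in [simp]: "hpart i x \<in> gr i"
  and finite_hpart [simp]: "finite {i. hpart i x \<noteq> 0}"
  using hpart_props by blast+

lemma sum_hpart:
  assumes "finite F" "\<And>i. i \<notin> F \<Longrightarrow> hpart i x = 0"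
  shows "(\<Sum>i\<in>F. hpart i x) = x"
proof -
  have "(\<Sum>i | hpart i x \<noteq> 0. hpart i x) = (\<Sum>i\<in>F. hpart i x)"
    using assms by (intro sum.mono_neutral_left) auto
  then show ?thesis using hpart_props[of x] by simp
qed

lemma hpart_bounded: "\<exists>N. \<forall>i>N. hpart i x = 0"
proof -
  have "\<forall>i>Max (insert 0 {i. hpart i x \<noteq> 0}). hpart i x = 0"
  proof (intro allI impI, rule ccontr)
    fix i assume "i > Max (insert 0 {i. hpart i x \<noteq> 0})" "hpart i x \<noteq> 0"
    moreover have "i \<le> Max (insert 0 {i. hpart i x \<noteq> 0})"
      using \<open>hpart i x \<noteq> 0\<close> by (intro Max_ge) auto
    ultimately show False by linarith
  qed
  then show ?thesis by blast
qed

text \<open>Padding \<open>h\<close> by zero outside \<open>F\<close> gives a decomposition of the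
  shape that the grading makes unique. Computations of \<open>hpart\<close> below come down to
  exhibiting such a decomposition.\<close>

lemma hpart_unique:
  assumes "finite F" "\<And>i. i \<in> F \<Longrightarrow> h i \<in> gr i" "x = (\<Sum>i\<in>F. h i)"
  shows "hpart i x = (if i \<in> F then h i else 0)"
proof -
  define h' where "h' i = (if i \<in> F then h i else 0)" for i
  have sub: "{i. h' i \<noteq> 0} \<subseteq> F" by (auto simp: h'_def)
  have "x = (\<Sum>i\<in>F. h' i)" using assms(3) by (simp add: h'_def)
  also have "\<dots> = sum h' {i. h' i \<noteq> 0}"
    using assms(1) sub by (intro sum.mono_neutral_right) auto
  finally have "(\<forall>i. h' i \<in> gr i) \<and> finite {i. h' i \<noteq> 0} \<and> x = sum h' {i. h' i \<noteq> 0}"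
    using assms(1,2) sub by (auto simp: h'_def gr_zero intro: finite_subset)
  then have "(\<lambda>i. hpart i x) = h'"
    unfolding hpart_def by (rule the1_equality[OF ex1_decomp])
  then show ?thesis by (metis h'_def)
qed

lemma hpart_gr: "x \<in> gr j \<Longrightarrow> hpart i x = (if i = j then x else 0)"
  using hpart_unique[of "{j}" "\<lambda>_. x" x i] by auto

lemma hpart_zero [simp]: "hpart i 0 = 0"
  using hpart_gr[OF gr_zero[of i], of i] by simp

lemma hpart_add: "hpart i (x + y) = hpart i x + hpart i y"
proof -
  let ?F = "{i. hpart i x \<noteq> 0} \<union> {i. hpart i y \<noteq> 0}"
  have "x + y = (\<Sum>i\<in>?F. hpart i x) + (\<Sum>i\<in>?F. hpart i y)"
    by (subst (1 2) sum_hpart) auto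
  then have "x + y = (\<Sum>i\<in>?F. hpart i x + hpart i y)" by (simp only: sum.distrib)
  then have "hpart i (x + y) = (if i \<in> ?F then hpart i x + hpart i y else 0)"
    by (intro hpart_unique) (auto simp: gr_add)
  then show ?thesis by auto
qed

lemma hpart_scale: "hpart i (\<iota> c * x) = \<iota> c * hpart i x"
proof -
  let ?F = "{i. hpart i x \<noteq> 0}"
  have "\<iota> c * x = \<iota> c * (\<Sum>i\<in>?F. hpart i x)"
    by (subst sum_hpart) auto
  then have "\<iota> c * x = (\<Sum>i\<in>?F. \<iota> c * hpart i x)" by (simp only: sum_distrib_left)
  then have "hpart i (\<iota> c * x) = (if i \<in> ?F then \<iota> c * hpart i x else 0)"
    by (intro hpart_unique) (auto simp: gr_scale)
  then show ?thesis by auto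
qed

lemma hpart_uminus: "hpart i (- x) = - hpart i x"
  using hpart_add[of i x "-x"] by (simp add: eq_neg_iff_add_eq_0 add.commute)

lemma hpart_diff: "hpart i (x - y) = hpart i x - hpart i y"
  using hpart_add[of i x "-y"] by (simp add: hpart_uminus)

lemma hpart_sum: "hpart i (sum g X) = (\<Sum>x\<in>X. hpart i (g x))"
  by (induction X rule: infinite_finite_induct) (auto simp: hpart_add)

lemma hpart_mult: "hpart n (x * y) = (\<Sum>i\<le>n. hpart i x * hpart (n - i) y)"
proof -
  obtain M where M: "\<forall>i>M. hpart i x = 0" using hpart_bounded by blast
  obtain N where N: "\<forall>i>N. hpart i y = 0" using hpart_bounded by blast
  \<comment> \<open>Both ranges are padded by \<open>n\<close>, so that they contain all indices
    \<open>i\<close> and \<open>n - i\<close> of the convolution.\<close>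
  have x: "x = (\<Sum>i\<le>M+n. hpart i x)" using M by (intro sum_hpart[symmetric]) auto
  have y: "y = (\<Sum>j\<le>N+n. hpart j y)" using N by (intro sum_hpart[symmetric]) auto
  have inner: "(\<Sum>j\<le>N+n. hpart n (hpart i x * hpart j y)) =
      (if i \<le> n then hpart i x * hpart (n - i) y else 0)" for i
  proof -
    have "(\<Sum>j\<le>N+n. hpart n (hpart i x * hpart j y)) =
        (\<Sum>j\<le>N+n. if j = n - i \<and> i \<le> n then hpart i x * hpart j y else 0)"
      by (intro sum.cong refl) (auto simp: hpart_gr[OF gr_mult[OF hpart_in hpart_in]])
    also have "\<dots> = (if i \<le> n then hpart i x * hpart (n - i) y else 0)"
      by (cases "i \<le> n") (auto simp: sum.delta)
    finally show ?thesis .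
  qed
  have "x * y = (\<Sum>i\<le>M+n. \<Sum>j\<le>N+n. hpart i x * hpart j y)"
    by (subst x, subst y) (simp only: sum_product)
  then have "hpart n (x * y) = (\<Sum>i\<le>M+n. if i \<le> n then hpart i x * hpart (n - i) y else 0)"
    by (simp add: hpart_sum inner)
  also have "\<dots> = (\<Sum>i\<le>n. hpart i x * hpart (n - i) y)"
    by (intro sum.mono_neutral_cong_right) auto
  finally show ?thesis .
qed

section \<open>Degree filtrations and truncation\<close>

definition low :: "nat \<Rightarrow> 'a set" where "low d = {x. \<forall>i>d. hpart i x = 0}"

definition high :: "nat \<Rightarrow> 'a set" where "high d = {x. \<forall>i<d. hpart i x = 0}"

definition trunc :: "nat \<Rightarrow> 'a \<Rightarrow> 'a" where "trunc d x = (\<Sum>i\<le>d. hpart i x)"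

lemma low_add: "x \<in> low d \<Longrightarrow> y \<in> low d \<Longrightarrow> x + y \<in> low d"
  and low_diff: "x \<in> low d \<Longrightarrow> y \<in> low d \<Longrightarrow> x - y \<in> low d"
  and low_scale: "x \<in> low d \<Longrightarrow> \<iota> c * x \<in> low d"
  and low_zero: "0 \<in> low d"
  and low_mono: "x \<in> low d \<Longrightarrow> d \<le> e \<Longrightarrow> x \<in> low e"
  by (auto simp: low_def hpart_add hpart_diff hpart_scale)

lemma high_add: "x \<in> high d \<Longrightarrow> y \<in> high d \<Longrightarrow> x + y \<in> high d"
  and high_diff: "x \<in> high d \<Longrightarrow> y \<in> high d \<Longrightarrow> x - y \<in> high d"
  and high_scale: "x \<in> high d \<Longrightarrow> \<iota> c * x \<in> high d"
  and high_zero: "0 \<in> high d"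
  and high_0: "x \<in> high 0"
  and high_mono: "x \<in> high d \<Longrightarrow> e \<le> d \<Longrightarrow> x \<in> high e"
  by (auto simp: high_def hpart_add hpart_diff hpart_scale)

lemma high_sum: "(\<And>x. x \<in> X \<Longrightarrow> g x \<in> high d) \<Longrightarrow> sum g X \<in> high d"
  by (induction X rule: infinite_finite_induct) (auto simp: high_zero high_add)

lemma low_mult:
  assumes "x \<in> low d" "y \<in> low e" shows "x * y \<in> low (d + e)"
proof -
  have "hpart i x * hpart (n - i) y = 0" if "n > d + e" for i n
    using assms that by (cases "i > d") (auto simp: low_def)
  then show ?thesis by (auto simp: low_def hpart_mult)
qed

lemma high_mult:
  assumes "x \<in> high d" "y \<in> high e" shows "x * y \<in> high (d + e)"
proof -
  have "hpart i x * hpart (n - i) y = 0" if "n < d + e" "i \<le> n" for i n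
    using assms that by (cases "i < d") (auto simp: high_def)
  then show ?thesis by (auto simp: high_def hpart_mult)
qed

lemma gr_low: "x \<in> gr d \<Longrightarrow> x \<in> low d"
  and gr_high: "x \<in> gr d \<Longrightarrow> x \<in> high d"
  by (auto simp: low_def high_def hpart_gr)

lemma iota_low: "\<iota> c \<in> low d"
  using gr_low[of "\<iota> c" 0] low_mono[of "\<iota> c" 0 d] by (simp add: gr_0)

lemma ex_low: "\<exists>d. x \<in> low d"
  using hpart_bounded[of x] by (auto simp: low_def)

lemma low_0: "x \<in> low 0 \<Longrightarrow> \<exists>c. x = \<iota> c"
  using sum_hpart[of "{0}" x] hpart_in[of 0 x] unfolding gr_0 by (auto simp: low_def)

lemma low_1: "x \<in> low 1 \<Longrightarrow> x = hpart 0 x + hpart 1 x"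
  using sum_hpart[of "{0, 1}" x] by (auto simp: low_def)

lemma hpart_trunc: "hpart i (trunc d x) = (if i \<le> d then hpart i x else 0)"
  unfolding trunc_def by (subst hpart_unique[of "{..d}" "\<lambda>i. hpart i x"]) auto

lemma trunc_high: "x - trunc d x \<in> high (Suc d)"
  by (auto simp: high_def hpart_trunc hpart_diff)

lemma trunc_of_low: "x \<in> low d \<Longrightarrow> trunc d x = x"
  unfolding trunc_def by (rule sum_hpart) (auto simp: low_def)

lemma trunc_of_high: "x \<in> high (Suc d) \<Longrightarrow> trunc d x = 0"
  by (simp add: trunc_def high_def)

lemma trunc_add: "trunc d (x + y) = trunc d x + trunc d y"
  and trunc_diff: "trunc d (x - y) = trunc d x - trunc d y"
  and trunc_scale: "trunc d (\<iota> c * x) = \<iota> c * trunc d x"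
  by (simp_all add: trunc_def hpart_add hpart_diff hpart_scale sum.distrib sum_subtractf sum_distrib_left)

lemma high_hpart: "x \<in> high d \<Longrightarrow> x - hpart d x \<in> high (Suc d)"
  by (auto simp: high_def less_Suc_eq hpart_diff hpart_gr[OF hpart_in])

text \<open>Such an element has no nonzero component and is the sum of its components. This
  separatedness yields the injectivity of \<open>filt_iso\<close>.\<close>

lemma high_all_zero: "(\<And>d. x \<in> high d) \<Longrightarrow> x = 0"
  using sum_hpart[of "{}" x] by (auto simp: high_def)

section \<open>Finite dimension of the graded and filtered pieces\<close>

text \<open>Generation in degree 1 makes the words of length \<open>d\<close> in a finite spanning
  set of \<open>gr 1\<close> span \<open>gr d\<close>.\<close>

lemma homog_finite_span: "\<exists>D. finite D \<and> D \<subseteq> gr d \<and> gr d \<subseteq> vs.span D"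
proof -
  obtain E where E: "finite E" "E \<subseteq> gr 1" "gr 1 = vs.span E" using fin_span by blast
  \<comment> \<open>\<open>D n\<close> consists of the words of length \<open>n\<close> in
    \<open>E\<close>; the empty word is \<open>1\<close>.\<close>
  define D where "D = rec_nat {1} (\<lambda>_ X. {u * v | u v. u \<in> E \<and> v \<in> X})"
  have D0: "D 0 = {1}" and DS: "D (Suc n) = {u * v | u v. u \<in> E \<and> v \<in> D n}" for n
    by (simp_all add: D_def)
  have fin: "finite (D n)" for n
  proof (induction n)
    case (Suc n)
    have "D (Suc n) = (\<lambda>(u, v). u * v) ` (E \<times> D n)" by (auto simp: DS)
    then show ?case using Suc E(1) by simp
  qed (simp add: D0)
  have sub: "D n \<subseteq> gr n" for n
  proof (induction n)
    case 0
    then show ?case by (auto simp: D0 gr_0 intro: range_eqI[of _ _ 1])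
  next
    case (Suc n)
    show ?case
    proof
      fix z assume "z \<in> D (Suc n)"
      then obtain u v where "z = u * v" "u \<in> E" "v \<in> D n" by (auto simp: DS)
      then show "z \<in> gr (Suc n)" using gr_mult[of u 1 v n] E(2) Suc by auto
    qed
  qed
  have D_mult: "u * v \<in> D (m + n)" if "u \<in> D m" "v \<in> D n" for u v m n
    using that(1)
  proof (induction m arbitrary: u)
    case 0
    then show ?case using that(2) by (simp add: D0)
  next
    case (Suc m)
    then obtain a b where ab: "u = a * b" "a \<in> E" "b \<in> D m" by (auto simp: DS)
    then have "b * v \<in> D (m + n)" using Suc.IH by blast
    then show ?case using ab by (auto simp: DS mult.assoc)
  qed
  have span_mult: "x * y \<in> vs.span (D (m + n))"
    if "x \<in> vs.span (D m)" "y \<in> vs.span (D n)" for x y m n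
    using mult_span[OF that] vs.span_mono[of "{u * v | u v. u \<in> D m \<and> v \<in> D n}" "D (m + n)"] D_mult
    by blast
  have scal: "hpart n (\<iota> c) \<in> vs.span (D n)" for c n
  proof -
    have "\<iota> c * 1 \<in> vs.span (D 0)" unfolding D0 by (intro vs.span_scale vs.span_base) simp
    then show ?thesis
      using hpart_gr[of "\<iota> c" 0 n] by (auto simp: gr_0 vs.span_zero)
  qed
  \<comment> \<open>Elements of \<open>gen_alg\<close> need not be homogeneous, so the induction
    treats all components at once; products are handled by \<open>hpart_mult\<close>.\<close>
  have "hpart n x \<in> vs.span (D n)" if "x \<in> gen_alg \<iota> (gr 1)" for x n
    using that
  proof (induction arbitrary: n)
    case (gen s)
    have "E \<subseteq> D 1" by (auto simp: DS D0)
    then have "s \<in> vs.span (D 1)" using gen E(3) vs.span_mono by blast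
    then show ?case using hpart_gr[OF gen, of n] by (auto simp: vs.span_zero)
  next
    case (scal c)
    show ?case by (rule \<open>\<And>n c. hpart n (\<iota> c) \<in> vs.span (D n)\<close>)
  next
    case (add x y)
    then show ?case by (simp add: hpart_add vs.span_add)
  next
    case (mult x y)
    have "hpart i x * hpart (n - i) y \<in> vs.span (D n)" if "i \<le> n" for i
      using span_mult[OF mult.IH(1)[of i] mult.IH(2)[of "n - i"]] that by simp
    then show ?case by (auto simp: hpart_mult intro: vs.span_sum)
  qed
  then have "hpart d x \<in> vs.span (D d)" for x using generated by blast
  then have "gr d \<subseteq> vs.span (D d)" using hpart_gr[of _ d d] by (metis subsetI)
  with fin[of d] sub[of d] show ?thesis by blast
qed

text \<open>The finite spanning sets of the degrees up to \<open>d\<close> are collected. Finite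
  dimension later turns surjective truncation maps into injective ones.\<close>

lemma low_finite_span: "\<exists>D. finite D \<and> low d = vs.span D"
proof -
  obtain D where D: "\<And>i. finite (D i)" "\<And>i. D i \<subseteq> gr i" "\<And>i. gr i \<subseteq> vs.span (D i)"
    using homog_finite_span by metis
  let ?D = "\<Union>i\<le>d. D i"
  have "low d \<subseteq> vs.span ?D"
  proof
    fix x assume x: "x \<in> low d"
    have "hpart i x \<in> vs.span ?D" if "i \<le> d" for i
      using D(3)[of i] hpart_in[of i x] vs.span_mono[of "D i" ?D] that by blast
    then have "trunc d x \<in> vs.span ?D" unfolding trunc_def by (auto intro: vs.span_sum)
    then show "x \<in> vs.span ?D" using trunc_of_low[OF x] by simp
  qed
  moreover have "vs.span ?D \<subseteq> low d"
  proof (rule vs.span_minimal)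
    show "?D \<subseteq> low d" using D(2) gr_low low_mono by blast
    show "vs.subspace (low d)" by (rule vs.subspaceI) (auto intro: low_zero low_add low_scale)
  qed
  ultimately show ?thesis using D(1) by (intro exI[of _ ?D]) auto
qed

end

text \<open>The library has this only when the span is the whole type.\<close>
lemma (in vector_space) surj_on_span_imp_zero_kernel:
  assumes lin: "Vector_Spaces.linear scale scale h"
    and fin: "finite D" and surj: "span D \<subseteq> h ` span D"
    and x: "x \<in> span D" "h x = 0"
  shows "x = 0"
proof -
  interpret h: Vector_Spaces.linear scale scale h by (rule lin)
  obtain B where B: "B \<subseteq> D" "independent B" "D \<subseteq> span B"
    using maximal_independent_subset[of D] by blast
  have spanB: "span B = span D"
    using B by (metis span_mono span_span subset_antisym)
  have finB: "finite B" using B(1) fin finite_subset by blast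
  \<comment> \<open>Surjectivity puts the basis \<open>B\<close> inside the span of its image. The
    exchange bound then gives the image as many elements as \<open>B\<close>, so \<open>h\<close> is
    injective on \<open>B\<close>.\<close>
  have Bsub: "B \<subseteq> span (h ` B)"
    using surj span_superset[of B] unfolding spanB[symmetric] h.span_image by blast
  have "card B \<le> card (h ` B)"
    using independent_span_bound[OF _ B(2) Bsub] finB by simp
  then have inj: "inj_on h B" using finB by (metis card_image_le eq_card_imp_inj_on le_antisym)
  have ind: "independent (h ` B)"
  proof
    assume "dependent (h ` B)"
    then obtain b where b: "b \<in> h ` B" "b \<in> span (h ` B - {b})" unfolding dependent_def by blast
    then have "B \<subseteq> span (h ` B - {b})" using Bsub by (metis insert_Diff span_redundant)
    then have "card B \<le> card (h ` B - {b})"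
      using independent_span_bound[OF _ B(2)] finB by simp
    moreover have "card (h ` B - {b}) < card (h ` B)" using b(1) finB by (intro psubset_card_mono) auto
    ultimately show False using card_image[OF inj] by simp
  qed
  have "inj_on h (span B)" using h.inj_on_span_iff_independent_image[OF ind] inj by simp
  then show ?thesis using x by (metis h.zero inj_onD span_zero spanB)
qed

subsection \<open>A filtered isomorphism from an ungraded one\<close>

lemma alg_iso_inv:
  assumes "alg_iso \<iota>A \<iota>B f" shows "alg_iso \<iota>B \<iota>A (inv f)"
proof -
  have bij: "bij f" and hom: "\<And>x y. f (x + y) = f x + f y" "\<And>x y. f (x * y) = f x * f y" "f 1 = 1"
    "\<And>c. f (\<iota>A c) = \<iota>B c"
    using assms unfolding alg_iso_def by blast+
  have inj: "inj f" and f_inv: "\<And>y. f (inv f y) = y"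
    using bij by (auto simp: bij_def surj_f_inv_f)
  show ?thesis
    unfolding alg_iso_def
    by (intro conjI allI bij_imp_bij_inv bij; rule injD[OF inj]) (simp_all only: f_inv hom)
qed

locale conn_graded_iso =
  R: conn_graded \<iota>R grR + S: conn_graded \<iota>S grS
  for \<iota>R :: "'k::field \<Rightarrow> 'r::ring_1" and grR and \<iota>S :: "'k \<Rightarrow> 's::ring_1" and grS +
  fixes f :: "'r \<Rightarrow> 's"
  assumes iso: "alg_iso \<iota>R \<iota>S f"
begin

lemma f_bij: "bij f"
  and f_add: "f (x + y) = f x + f y"
  and f_mult: "f (x * y) = f x * f y"
  and f_iota: "f (\<iota>R c) = \<iota>S c"
  using iso unfolding alg_iso_def by blast+

lemma f_zero: "f 0 = 0"
  using f_add[of 0 0] by simp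

lemma f_diff: "f (x - y) = f x - f y"
  using f_add[of "x - y" y] by (simp add: algebra_simps)

lemma f_sum: "f (sum g X) = (\<Sum>x\<in>X. f (g x))"
  by (induction X rule: infinite_finite_induct) (auto simp: f_zero f_add)

lemma f_inv: "f (inv f y) = y" "inv f (f x) = x"
  using f_bij by (auto simp: bij_def surj_f_inv_f)

text \<open>The generators of \<open>R\<close>, corrected by scalars, lie in \<open>R.low 1\<close> and are mapped into \<open>S.high 1\<close>;
  hence \<open>R\<close> is spanned by elements that lie in some \<open>R.low i\<close> and are mapped into \<open>S.high i\<close>.\<close>
lemma low_high_split: "\<exists>w\<in>R.low d. f (x - w) \<in> S.high (Suc d)"
proof -
  define W where "W i = {x \<in> R.low i. f x \<in> S.high i}" for i
  define U where "U = (\<Union>i. W i)"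
  have iota_W: "\<iota>R c \<in> W 0" for c by (simp add: W_def R.iota_low S.high_0)
  have WU: "x \<in> W i \<Longrightarrow> x \<in> R.vs.span U" for x i
    by (auto simp: U_def intro!: R.vs.span_base)
  have "x \<in> R.vs.span U" if "x \<in> gen_alg \<iota>R (grR 1)" for x
    using that
  proof induction
    case (gen s)
    obtain c where c: "S.hpart 0 (f s) = \<iota>S c" using S.hpart_in[of 0 "f s"] S.gr_0 by blast
    have "f (s - \<iota>R c) \<in> S.high 1"
      using c S.hpart_gr[of "\<iota>S c" 0 0] by (simp add: S.high_def f_diff f_iota S.hpart_diff S.gr_0)
    then have "s - \<iota>R c \<in> W 1"
      using R.gr_low[OF gen] by (auto simp: W_def intro: R.low_diff R.iota_low)
    from R.vs.span_add[OF WU[OF this] WU[OF iota_W[of c]]] show ?case by simp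
  next
    case (scal c)
    show ?case by (rule WU[OF iota_W])
  next
    case (add x y)
    then show ?case by (rule_tac R.vs.span_add)
  next
    case (mult x y)
    \<comment> \<open>A product of elements of \<open>W i\<close> and \<open>W j\<close> lies in
      \<open>W (i + j)\<close>, because \<open>f\<close> is multiplicative and both filtrations
      are.\<close>
    have "{u * v | u v. u \<in> U \<and> v \<in> U} \<subseteq> U"
      unfolding U_def W_def by (auto simp: f_mult intro!: R.low_mult S.high_mult)
    then show ?case using R.mult_span[OF mult.IH] R.vs.span_mono by blast
  qed
  then have "x \<in> R.vs.span U" using R.generated by blast
  then show ?thesis
  proof (induction rule: R.vs.span_induct)
    case base
    show ?case
    proof (rule R.vs.subspaceI; clarify)
      show "\<exists>w\<in>R.low d. f (0 - w) \<in> S.high (Suc d)"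
        using R.low_zero by (intro bexI[of _ 0]) (simp_all add: f_zero S.high_zero)
    next
      fix x y w v
      assume "w \<in> R.low d" "v \<in> R.low d" "f (x - w) \<in> S.high (Suc d)" "f (y - v) \<in> S.high (Suc d)"
      moreover have "f (x + y - (w + v)) = f (x - w) + f (y - v)" by (simp add: f_diff f_add)
      ultimately show "\<exists>w\<in>R.low d. f (x + y - w) \<in> S.high (Suc d)"
        by (intro bexI[of _ "w + v"]) (simp_all add: S.high_add R.low_add)
    next
      fix c x w
      assume "w \<in> R.low d" "f (x - w) \<in> S.high (Suc d)"
      moreover have "f (\<iota>R c * x - \<iota>R c * w) = \<iota>S c * f (x - w)"
        by (simp add: f_mult f_iota flip: right_diff_distrib)
      ultimately show "\<exists>w\<in>R.low d. f (\<iota>R c * x - w) \<in> S.high (Suc d)"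
        by (intro bexI[of _ "\<iota>R c * w"]) (simp_all add: S.high_scale R.low_scale)
    qed
  next
    case (step x)
    then obtain i where i: "x \<in> R.low i" "f x \<in> S.high i" by (auto simp: U_def W_def)
    show ?case
    \<comment> \<open>Either \<open>x\<close> itself is low enough to serve as \<open>w\<close>, or
      \<open>i\<close> is at least \<open>Suc d\<close>, so that \<open>f x\<close> is already high
      enough and \<open>w = 0\<close> works.\<close>
    proof (cases "i \<le> d")
      case True
      then show ?thesis using R.low_mono[OF i(1)] S.high_zero by (intro bexI[of _ x]) (simp_all add: f_zero)
    next
      case False
      then show ?thesis using S.high_mono[OF i(2)] R.low_zero by (intro bexI[of _ 0]) simp_all
    qed
  qed
qed

text \<open>By \<open>low_high_split\<close>, the preimage \<open>inv f y\<close> has a part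
  \<open>w\<close> in \<open>R.low d\<close> whose image differs from \<open>y\<close> only above
  degree \<open>d\<close>.\<close>

lemma trunc_f_surj:
  assumes "y \<in> S.low d"
  shows "\<exists>w\<in>R.low d. S.trunc d (f w) = y"
proof -
  obtain w where w: "w \<in> R.low d" "f (inv f y - w) \<in> S.high (Suc d)"
    using low_high_split by blast
  then have "S.trunc d (y - f w) = 0" using S.trunc_of_high by (simp add: f_diff f_inv)
  then show ?thesis using w(1) S.trunc_of_low[OF assms] by (auto simp: S.trunc_diff)
qed

text \<open>Apply \<open>f\<close>, truncate, apply \<open>inv f\<close>, truncate: since
  \<open>trunc_f_surj\<close> holds in both directions, this round trip \<open>h\<close> maps the
  finite-dimensional space \<open>R.low d\<close> onto itself and so has zero kernel there. The
  first truncation already kills \<open>f x\<close>.\<close>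

lemma low_high_zero:
  assumes "x \<in> R.low d" "f x \<in> S.high (Suc d)"
  shows "x = 0"
proof -
  interpret I: conn_graded_iso \<iota>S grS \<iota>R grR "inv f"
    by unfold_locales (rule alg_iso_inv[OF iso])
  define h where "h x = R.trunc d (inv f (S.trunc d (f x)))" for x
  obtain D where D: "finite D" "R.low d = R.vs.span D" using R.low_finite_span by blast
  have lin: "Vector_Spaces.linear (\<lambda>c x. \<iota>R c * x) (\<lambda>c x. \<iota>R c * x) h"
    by unfold_locales
       (simp_all add: h_def f_add f_mult f_iota S.trunc_add S.trunc_scale I.f_add I.f_mult I.f_iota
          R.trunc_add R.trunc_scale)
  have "R.low d \<subseteq> h ` R.low d"
  proof
    fix x assume "x \<in> R.low d"
    then obtain y where y: "y \<in> S.low d" "R.trunc d (inv f y) = x" using I.trunc_f_surj by blast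
    obtain w where "w \<in> R.low d" "S.trunc d (f w) = y" using trunc_f_surj[OF y(1)] by blast
    with y(2) show "x \<in> h ` R.low d" by (intro image_eqI[of _ _ w]) (simp_all add: h_def)
  qed
  moreover have "h x = 0"
    using S.trunc_of_high[OF assms(2)] R.trunc_of_high[OF R.high_zero] by (simp add: h_def I.f_zero)
  ultimately show ?thesis
    using R.vs.surj_on_span_imp_zero_kernel[OF lin D(1)] assms(1) unfolding D(2) by blast
qed

section \<open>Lifting leading parts\<close>

text \<open>For \<open>s\<close> homogeneous of degree \<open>d\<close>, the description has a
  solution by \<open>trunc_f_surj\<close> and only one by \<open>low_high_zero\<close>.\<close>

definition lift :: "nat \<Rightarrow> 's \<Rightarrow> 'r" where
  "lift d s = (THE w. w \<in> R.low d \<and> f w - s \<in> S.high (Suc d))"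

text \<open>Two candidates differ by an element of \<open>R.low d\<close> that \<open>f\<close> maps
  into \<open>S.high (Suc d)\<close>, hence by zero. Algebraic identities for \<open>lift\<close>
  follow by exhibiting a candidate.\<close>

lemma lift_unique:
  assumes "w \<in> R.low d" "f w - s \<in> S.high (Suc d)" shows "lift d s = w"
  unfolding lift_def
proof (rule the_equality)
  fix v assume v: "v \<in> R.low d \<and> f v - s \<in> S.high (Suc d)"
  have "f (v - w) = (f v - s) - (f w - s)" by (simp add: f_diff)
  then have "f (v - w) \<in> S.high (Suc d)" using assms v S.high_diff by metis
  then have "v - w = 0" using low_high_zero R.low_diff assms v by blast
  then show "v = w" by simp
qed (use assms in blast)

lemma lift_props:
  assumes "s \<in> grS d"
  shows "lift d s \<in> R.low d" "f (lift d s) - s \<in> S.high (Suc d)"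
proof -
  obtain w where w: "w \<in> R.low d" "S.trunc d (f w) = s"
    using trunc_f_surj[OF S.gr_low[OF assms]] by blast
  then have *: "f w - s \<in> S.high (Suc d)" using S.trunc_high by blast
  with w(1) show "lift d s \<in> R.low d" "f (lift d s) - s \<in> S.high (Suc d)"
    using lift_unique by auto
qed

lemma lift_zero: "lift d 0 = 0"
  by (rule lift_unique) (auto simp: R.low_zero f_zero S.high_zero)

lemma lift_add:
  assumes "s \<in> grS d" "t \<in> grS d" shows "lift d (s + t) = lift d s + lift d t"
proof (rule lift_unique)
  have "f (lift d s + lift d t) - (s + t) = (f (lift d s) - s) + (f (lift d t) - t)"
    by (simp add: f_add)
  then show "f (lift d s + lift d t) - (s + t) \<in> S.high (Suc d)"
    using assms lift_props(2) S.high_add by metis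
qed (use assms lift_props(1) R.low_add in blast)

lemma lift_mult:
  assumes "s \<in> grS d" "t \<in> grS e" shows "lift (d + e) (s * t) = lift d s * lift e t"
proof (rule lift_unique)
  let ?x = "f (lift d s) - s" and ?y = "f (lift e t) - t"
  \<comment> \<open>Expand the product of \<open>s + ?x\<close> and \<open>t + ?y\<close>. Each
    error term contains \<open>?x\<close> or \<open>?y\<close>, which gains at least one degree over
    \<open>d + e\<close>.\<close>
  have "f (lift d s * lift e t) - s * t = ?x * ?y + ?x * t + s * ?y"
    by (simp add: f_mult algebra_simps)
  moreover have "?x * ?y \<in> S.high (Suc (d + e))"
    using S.high_mult[OF lift_props(2)[OF assms(1)] lift_props(2)[OF assms(2)]]
    by (rule S.high_mono) simp
  moreover have "?x * t \<in> S.high (Suc (d + e))"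
    using S.high_mult[OF lift_props(2)[OF assms(1)] S.gr_high[OF assms(2)]] by simp
  moreover have "s * ?y \<in> S.high (Suc (d + e))"
    using S.high_mult[OF S.gr_high[OF assms(1)] lift_props(2)[OF assms(2)]] by simp
  ultimately show "f (lift d s * lift e t) - s * t \<in> S.high (Suc (d + e))"
    by (simp add: S.high_add)
qed (use assms lift_props(1) R.low_mult in blast)

text \<open>In degree \<open>d\<close> this is \<open>inv f\<close> followed by the projection onto
  \<open>R.low d\<close> along the preimage of \<open>S.high (Suc d)\<close>.\<close>

definition filt_iso :: "'s \<Rightarrow> 'r" where
  "filt_iso x = (\<Sum>d | S.hpart d x \<noteq> 0. lift d (S.hpart d x))"

lemma filt_iso_eq:
  assumes "finite F" "\<And>d. d \<notin> F \<Longrightarrow> S.hpart d x = 0"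
  shows "filt_iso x = (\<Sum>d\<in>F. lift d (S.hpart d x))"
  unfolding filt_iso_def using assms by (intro sum.mono_neutral_left) (auto simp: lift_zero)

lemma filt_iso_gr: "s \<in> grS d \<Longrightarrow> filt_iso s = lift d s"
  by (subst filt_iso_eq[of "{d}"]) (auto simp: S.hpart_gr)

lemma filt_iso_add: "filt_iso (x + y) = filt_iso x + filt_iso y"
proof -
  let ?F = "{i. S.hpart i x \<noteq> 0} \<union> {i. S.hpart i y \<noteq> 0}"
  have "filt_iso (x + y) = (\<Sum>d\<in>?F. lift d (S.hpart d (x + y)))"
    by (rule filt_iso_eq) (auto simp: S.hpart_add)
  also have "\<dots> = (\<Sum>d\<in>?F. lift d (S.hpart d x)) + (\<Sum>d\<in>?F. lift d (S.hpart d y))"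
    by (simp only: S.hpart_add lift_add[OF S.hpart_in S.hpart_in] sum.distrib)
  also have "(\<Sum>d\<in>?F. lift d (S.hpart d x)) = filt_iso x"
    by (rule filt_iso_eq[symmetric]) auto
  also have "(\<Sum>d\<in>?F. lift d (S.hpart d y)) = filt_iso y"
    by (rule filt_iso_eq[symmetric]) auto
  finally show ?thesis .
qed

lemma filt_iso_zero: "filt_iso 0 = 0"
  using filt_iso_add[of 0 0] by simp

lemma filt_iso_diff: "filt_iso (x - y) = filt_iso x - filt_iso y"
  using filt_iso_add[of "x - y" y] by (simp add: algebra_simps)

lemma filt_iso_sum: "filt_iso (sum g X) = (\<Sum>x\<in>X. filt_iso (g x))"
  by (induction X rule: infinite_finite_induct) (auto simp: filt_iso_zero filt_iso_add)

lemma filt_iso_mult: "filt_iso (x * y) = filt_iso x * filt_iso y"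
proof -
  let ?X = "{i. S.hpart i x \<noteq> 0}" and ?Y = "{i. S.hpart i y \<noteq> 0}"
  have "x * y = (\<Sum>i\<in>?X. S.hpart i x) * (\<Sum>j\<in>?Y. S.hpart j y)"
    by (subst (1 2) S.sum_hpart) auto
  also have "\<dots> = (\<Sum>i\<in>?X. \<Sum>j\<in>?Y. S.hpart i x * S.hpart j y)" by (rule sum_product)
  finally have "filt_iso (x * y) = (\<Sum>i\<in>?X. \<Sum>j\<in>?Y. filt_iso (S.hpart i x * S.hpart j y))"
    by (simp only: filt_iso_sum)
  also have "\<dots> = (\<Sum>i\<in>?X. \<Sum>j\<in>?Y. lift i (S.hpart i x) * lift j (S.hpart j y))"
    by (intro sum.cong refl)
       (simp only: filt_iso_gr[OF S.gr_mult[OF S.hpart_in S.hpart_in]] lift_mult[OF S.hpart_in S.hpart_in])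
  also have "\<dots> = filt_iso x * filt_iso y" unfolding filt_iso_def by (rule sum_product[symmetric])
  finally show ?thesis .
qed

lemma filt_iso_iota: "filt_iso (\<iota>S c) = \<iota>R c"
proof -
  have "filt_iso (\<iota>S c) = lift 0 (\<iota>S c)" by (rule filt_iso_gr) (simp add: S.gr_0)
  also have "\<dots> = \<iota>R c" by (rule lift_unique) (simp_all add: R.iota_low f_iota S.high_zero)
  finally show ?thesis .
qed

text \<open>A component of degree \<open>i \<ge> d\<close> contributes an error in
  \<open>S.high (Suc i)\<close>. Thus \<open>f\<close> after \<open>filt_iso\<close> is the identity
  on the associated graded pieces of \<open>S.high\<close>.\<close>

lemma filt_iso_leading:
  assumes "x \<in> S.high d" shows "f (filt_iso x) - x \<in> S.high (Suc d)"
proof -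
  let ?X = "{i. S.hpart i x \<noteq> 0}"
  have "f (filt_iso x) - x = f (filt_iso x) - (\<Sum>i\<in>?X. S.hpart i x)"
    by (subst S.sum_hpart) auto
  also have "\<dots> = (\<Sum>i\<in>?X. f (lift i (S.hpart i x)) - S.hpart i x)"
    by (simp add: filt_iso_def f_sum sum_subtractf)
  also have "\<dots> \<in> S.high (Suc d)"
  proof -
    have step: "f (lift i (S.hpart i x)) - S.hpart i x \<in> S.high (Suc d)" if "i \<in> ?X" for i
    proof -
      have "d \<le> i" using assms that by (auto simp: S.high_def not_less[symmetric])
      then show ?thesis using S.high_mono[OF lift_props(2)[OF S.hpart_in]] by simp
    qed
    show ?thesis by (intro S.high_sum step)
  qed
  finally show ?thesis .
qed

text \<open>By \<open>filt_iso_leading\<close>, a kernel element in \<open>S.high d\<close> already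
  lies in \<open>S.high (Suc d)\<close>. Inductively it lies in every piece and vanishes by
  \<open>high_all_zero\<close>.\<close>

lemma filt_iso_inj: "inj filt_iso"
proof (rule injI)
  fix x y assume "filt_iso x = filt_iso y"
  then have 0: "filt_iso (x - y) = 0" by (simp add: filt_iso_diff)
  have "x - y \<in> S.high d" for d
  proof (induction d)
    case (Suc d)
    from S.high_diff[OF S.high_zero filt_iso_leading[OF Suc]] show ?case by (simp add: 0 f_zero)
  qed (rule S.high_0)
  then show "x = y" using S.high_all_zero[of "x - y"] by simp
qed

text \<open>Induction on the filtration: \<open>low_high_split\<close> leaves a difference
  \<open>x - w\<close> in \<open>R.low (Suc d)\<close> with image in \<open>S.high (Suc d)\<close>,
  and this is the lift of the degree \<open>Suc d\<close> component of its image.\<close>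

lemma low_subset_range: "R.low d \<subseteq> range filt_iso"
proof (induction d)
  case 0
  show ?case using R.low_0 filt_iso_iota by (metis rangeI subsetI)
next
  case (Suc d)
  show ?case
  proof
    fix x assume x: "x \<in> R.low (Suc d)"
    obtain w where w: "w \<in> R.low d" "f (x - w) \<in> S.high (Suc d)" using low_high_split by blast
    let ?s = "S.hpart (Suc d) (f (x - w))"
    have "lift (Suc d) ?s = x - w"
      using x w(2) R.low_mono[OF w(1), of "Suc d"]
      by (intro lift_unique S.high_hpart R.low_diff) auto
    then have "filt_iso ?s = x - w" using filt_iso_gr[OF S.hpart_in] by simp
    moreover obtain s where "w = filt_iso s" using Suc w(1) by blast
    ultimately have "x = filt_iso (?s + s)" by (simp add: filt_iso_add)
    then show "x \<in> range filt_iso" by blast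
  qed
qed

lemma alg_iso_filt_iso: "alg_iso \<iota>S \<iota>R filt_iso"
proof -
  have "surj filt_iso" using low_subset_range R.ex_low by blast
  then show ?thesis
    unfolding alg_iso_def bij_def
    using filt_iso_inj filt_iso_add filt_iso_mult filt_iso_iota filt_iso_iota[of 1] by simp
qed

text \<open>An ungraded isomorphism such as \<open>inv f\<close> may raise degrees; this bound is
  the reason for replacing it by \<open>filt_iso\<close>.\<close>

lemma filt_iso_low: "s \<in> grS d \<Longrightarrow> filt_iso s \<in> R.low d"
  by (simp add: filt_iso_gr lift_props(1))

end

subsection \<open>Polynomial extensions\<close>

abbreviation const_poly :: "'a::zero \<Rightarrow> ('n \<Rightarrow>\<^sub>0 nat) \<Rightarrow>\<^sub>0 'a" where
  "const_poly \<equiv> Poly_Mapping.single 0"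

abbreviation monomial :: "('n \<Rightarrow>\<^sub>0 nat) \<Rightarrow> ('n \<Rightarrow>\<^sub>0 nat) \<Rightarrow>\<^sub>0 'a::zero_neq_one" where
  "monomial m \<equiv> Poly_Mapping.single m 1"

abbreviation var :: "'n \<Rightarrow> ('n \<Rightarrow>\<^sub>0 nat) \<Rightarrow>\<^sub>0 'a::zero_neq_one" where
  "var i \<equiv> monomial (Poly_Mapping.single i 1)"

definition mdeg :: "('n::finite \<Rightarrow>\<^sub>0 nat) \<Rightarrow> nat" where
  "mdeg m = (\<Sum>i\<in>UNIV. Poly_Mapping.lookup m i)"

lemma mdeg_add: "mdeg (m + m') = mdeg m + mdeg m'"
  by (simp add: mdeg_def lookup_add sum.distrib)

lemma mdeg_eq_0_iff: "mdeg m = 0 \<longleftrightarrow> m = 0"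
  by (auto simp: mdeg_def intro: poly_mapping_eqI)

lemma mdeg_zero [simp]: "mdeg 0 = 0"
  by (simp add: mdeg_eq_0_iff)

lemma mdeg_single [simp]: "mdeg (Poly_Mapping.single i k) = k"
  by (simp add: mdeg_def lookup_single when_def)

lemma mdeg_eq_1_iff: "mdeg m = 1 \<longleftrightarrow> (\<exists>i. m = Poly_Mapping.single i 1)"
proof
  assume m: "mdeg m = 1"
  then obtain i where i: "Poly_Mapping.lookup m i \<noteq> 0" unfolding mdeg_def
    by (metis sum.neutral zero_neq_one)
  have "1 = Poly_Mapping.lookup m i + (\<Sum>j\<in>UNIV - {i}. Poly_Mapping.lookup m j)"
    using m unfolding mdeg_def by (simp add: sum.remove[of UNIV i])
  with i have *: "Poly_Mapping.lookup m i = 1"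
    and **: "(\<Sum>j\<in>UNIV - {i}. Poly_Mapping.lookup m j) = 0" by linarith+
  have "m = Poly_Mapping.single i 1"
    using * ** by (intro poly_mapping_eqI) (auto simp: lookup_single when_def)
  then show "\<exists>i. m = Poly_Mapping.single i 1" by blast
qed auto

lemma poly_mapping_sum_singles:
  "p = (\<Sum>k\<in>Poly_Mapping.keys p. Poly_Mapping.single k (Poly_Mapping.lookup p k))"
  by (rule poly_mapping_eqI) (auto simp: lookup_sum lookup_single when_def in_keys_iff)

text \<open>Constants and variables generate the polynomial ring: build powers of a variable, then
  monomials, then terms, then sums of terms.\<close>

lemma poly_induct [case_names const var add mult]:
  fixes p :: "('n \<Rightarrow>\<^sub>0 nat) \<Rightarrow>\<^sub>0 'a::ring_1"
  assumes const: "\<And>a. P (const_poly a)" and var: "\<And>i. P (var i)"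
    and add: "\<And>p q. P p \<Longrightarrow> P q \<Longrightarrow> P (p + q)" and mult: "\<And>p q. P p \<Longrightarrow> P q \<Longrightarrow> P (p * q)"
  shows "P p"
proof -
  have pow: "P (monomial (Poly_Mapping.single i k))" for i k
  proof (induction k)
    case 0
    show ?case using const[of 1] by simp
  next
    case (Suc k)
    have "monomial (Poly_Mapping.single i (Suc k)) = (var i * monomial (Poly_Mapping.single i k) :: ('n \<Rightarrow>\<^sub>0 nat) \<Rightarrow>\<^sub>0 'a)"
      by (simp add: mult_single flip: single_add)
    then show ?case using mult[OF var Suc] by simp
  qed
  have mon_sum: "P (monomial (\<Sum>i\<in>F. Poly_Mapping.single i (e i)))" if "finite F" for F e
    using that
  proof induction
    case empty
    show ?case using const[of 1] by simp
  next
    case (insert i F)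
    then show ?case using mult[OF pow[of i "e i"] insert.IH] by (simp add: mult_single)
  qed
  have mon: "P (monomial m)" for m
    using mon_sum[OF finite_keys, of "Poly_Mapping.lookup m" m] by (simp flip: poly_mapping_sum_singles)
  have single: "P (Poly_Mapping.single m a)" for m a
    using mult[OF const[of a] mon[of m]] by (simp add: mult_single)
  have "P (\<Sum>m\<in>F. Poly_Mapping.single m (e m))" if "finite F" for F e
    using that by induction (use const[of 0] add single in auto)
  from this[OF finite_keys, of "Poly_Mapping.lookup p" p] show ?thesis
    by (simp flip: poly_mapping_sum_singles)
qed

lemma commutes_mult:
  fixes a p q :: "'a::semigroup_mult"
  assumes "a * p = p * a" "a * q = q * a" shows "a * (p * q) = p * q * a"
proof -
  have "a * (p * q) = p * (a * q)" by (simp only: assms(1) flip: mult.assoc)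
  then show ?thesis by (simp only: assms(2) mult.assoc)
qed

lemma var_central: "var i * p = p * var i" for p :: "('n \<Rightarrow>\<^sub>0 nat) \<Rightarrow>\<^sub>0 'a::ring_1"
proof (induction p rule: poly_induct)
  case (mult p q)
  then show ?case by (rule commutes_mult)
qed (simp_all add: mult_single add.commute distrib_left distrib_right)

lemma lookup_const_mult:
  "Poly_Mapping.lookup (const_poly a * p) m = a * Poly_Mapping.lookup p m"
  for p :: "('n \<Rightarrow>\<^sub>0 nat) \<Rightarrow>\<^sub>0 'a::ring_1"
  by (simp add: map.rep_eq when_def flip: mult_map_scale_conv_mult)

context central_algebra
begin

lemma poly_central_algebra:
  "central_algebra (poly_iota \<iota> :: 'k \<Rightarrow> ('n \<Rightarrow>\<^sub>0 nat) \<Rightarrow>\<^sub>0 'a)"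
proof
  have "const_poly (\<iota> c) * p = p * const_poly (\<iota> c)" for c and p :: "('n \<Rightarrow>\<^sub>0 nat) \<Rightarrow>\<^sub>0 'a"
  proof (induction p rule: poly_induct)
    case (mult p q)
    then show ?case by (rule commutes_mult)
  next
    case (const a)
    then show ?case using iota_central[of c a] by (simp add: mult_single)
  qed (simp_all add: mult_single distrib_left distrib_right)
  then show "algebra_str (poly_iota \<iota> :: 'k \<Rightarrow> ('n \<Rightarrow>\<^sub>0 nat) \<Rightarrow>\<^sub>0 'a)"
    unfolding algebra_str_def poly_iota_def
    by (simp add: iota_add iota_mult mult_single single_add)
qed

section \<open>Evaluation at scalar points\<close>

definition poly_eval :: "('n::finite \<Rightarrow> 'k) \<Rightarrow> (('n \<Rightarrow>\<^sub>0 nat) \<Rightarrow>\<^sub>0 'a) \<Rightarrow> 'a" where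
  "poly_eval d p = (\<Sum>m\<in>Poly_Mapping.keys p.
     Poly_Mapping.lookup p m * \<iota> (\<Prod>i\<in>UNIV. d i ^ Poly_Mapping.lookup m i))"

lemma poly_eval_superset:
  assumes "finite F" "Poly_Mapping.keys p \<subseteq> F"
  shows "poly_eval d p = (\<Sum>m\<in>F. Poly_Mapping.lookup p m * \<iota> (\<Prod>i\<in>UNIV. d i ^ Poly_Mapping.lookup m i))"
  unfolding poly_eval_def using assms by (intro sum.mono_neutral_left) (auto simp: in_keys_iff)

lemma poly_eval_add: "poly_eval d (p + q) = poly_eval d p + poly_eval d q"
proof -
  let ?F = "Poly_Mapping.keys p \<union> Poly_Mapping.keys q"
  have "poly_eval d (p + q) = (\<Sum>m\<in>?F. Poly_Mapping.lookup (p + q) m * \<iota> (\<Prod>i\<in>UNIV. d i ^ Poly_Mapping.lookup m i))"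
    by (rule poly_eval_superset) (auto simp: keys_add)
  also have "\<dots> = poly_eval d p + poly_eval d q"
    by (simp add: poly_eval_superset[of ?F p] poly_eval_superset[of ?F q] lookup_add distrib_right sum.distrib)
  finally show ?thesis .
qed

lemma poly_eval_single:
  "poly_eval d (Poly_Mapping.single m a) = a * \<iota> (\<Prod>i\<in>UNIV. d i ^ Poly_Mapping.lookup m i)"
  by (subst poly_eval_superset[of "{m}"]) auto

lemma poly_eval_zero [simp]: "poly_eval d 0 = 0"
  by (simp add: poly_eval_def)

lemma poly_eval_sum: "poly_eval d (sum g X) = (\<Sum>x\<in>X. poly_eval d (g x))"
  by (induction X rule: infinite_finite_induct) (auto simp: poly_eval_add)

lemma poly_eval_const [simp]: "poly_eval d (const_poly a) = a"
  by (simp add: poly_eval_single)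

lemma poly_eval_iota [simp]: "poly_eval d (poly_iota \<iota> c) = \<iota> c"
  by (simp add: poly_iota_def)

lemma poly_eval_var: "poly_eval d (var i) = \<iota> (d i)"
proof -
  have "(\<Prod>j\<in>UNIV. d j ^ Poly_Mapping.lookup (Poly_Mapping.single i 1) j) = (\<Prod>j\<in>UNIV. if j = i then d j else 1)"
    by (intro prod.cong) (auto simp: lookup_single when_def)
  then show ?thesis by (simp add: poly_eval_single)
qed

lemma poly_eval_mult: "poly_eval d (p * q) = poly_eval d p * poly_eval d q"
proof -
  let ?s = "\<lambda>p m. Poly_Mapping.single m (Poly_Mapping.lookup p m)"
  \<comment> \<open>On single terms, the exponents add and the values at the point, being central
    scalars, move past the coefficient \<open>b\<close>.\<close>
  have single: "poly_eval d (Poly_Mapping.single m a * Poly_Mapping.single m' b) =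
      poly_eval d (Poly_Mapping.single m a) * poly_eval d (Poly_Mapping.single m' b)" for m m' a b
    by (simp add: mult_single poly_eval_single lookup_add power_add prod.distrib iota_mult
        mult.assoc iota_left_commute)
  have "p * q = (\<Sum>m\<in>Poly_Mapping.keys p. ?s p m) * (\<Sum>m\<in>Poly_Mapping.keys q. ?s q m)"
    by (simp flip: poly_mapping_sum_singles)
  then have "poly_eval d (p * q) =
      (\<Sum>m\<in>Poly_Mapping.keys p. poly_eval d (?s p m)) * (\<Sum>m\<in>Poly_Mapping.keys q. poly_eval d (?s q m))"
    by (simp add: sum_product poly_eval_sum single)
  then show ?thesis by (simp flip: poly_eval_sum poly_mapping_sum_singles)
qed

text \<open>Both sides agree on constants and, by the last assumption, on variables, so they agree
  everywhere. This is factorization through the quotient by the ideal generated by the differences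
  of \<open>var i\<close> and \<open>d i\<close>, expressed without quotients.\<close>

lemma hom_factors_through_eval:
  fixes H :: "(('n::finite \<Rightarrow>\<^sub>0 nat) \<Rightarrow>\<^sub>0 'a) \<Rightarrow> 'b::ring_1"
  assumes "\<And>p q. H (p + q) = H p + H q" "\<And>p q. H (p * q) = H p * H q"
    and "\<And>i. H (var i) = H (const_poly (\<iota> (d i)))"
  shows "H (const_poly (poly_eval d p)) = H p"
proof (induction p rule: poly_induct)
  case (add p q)
  then show ?case using assms(1) by (simp add: poly_eval_add single_add)
next
  case (mult p q)
  have "(const_poly (poly_eval d (p * q)) :: ('n \<Rightarrow>\<^sub>0 nat) \<Rightarrow>\<^sub>0 'a)
      = const_poly (poly_eval d p) * const_poly (poly_eval d q)"
    by (simp add: poly_eval_mult mult_single)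
  then show ?case using assms(2) mult by simp
qed (simp_all add: assms(3) poly_eval_var del: One_nat_def)

end

section \<open>The total-degree grading\<close>

text \<open>Variables have degree 1. The guard is essential: for \<open>mdeg m > d\<close> natural
  subtraction would give degree 0 and admit scalar coefficients.\<close>

definition poly_gr :: "(nat \<Rightarrow> 'a::ring_1 set) \<Rightarrow> nat \<Rightarrow> (('n::finite \<Rightarrow>\<^sub>0 nat) \<Rightarrow>\<^sub>0 'a) set" where
  "poly_gr gr d = {p. \<forall>m. Poly_Mapping.lookup p m \<in> (if mdeg m \<le> d then gr (d - mdeg m) else {0})}"

context conn_graded
begin

lemma poly_gr_zero: "0 \<in> poly_gr gr d"
  by (auto simp: poly_gr_def gr_zero)

lemma poly_gr_add: "p \<in> poly_gr gr d \<Longrightarrow> q \<in> poly_gr gr d \<Longrightarrow> p + q \<in> poly_gr gr d"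
  by (fastforce simp: poly_gr_def lookup_add gr_add split: if_splits)

lemma poly_gr_sum: "(\<And>x. x \<in> X \<Longrightarrow> g x \<in> poly_gr gr d) \<Longrightarrow> sum g X \<in> poly_gr gr d"
  by (induction X rule: infinite_finite_induct) (auto simp: poly_gr_zero poly_gr_add)

lemma poly_gr_scale: "p \<in> poly_gr gr d \<Longrightarrow> poly_iota \<iota> c * p \<in> poly_gr gr d"
  by (fastforce simp: poly_gr_def poly_iota_def lookup_const_mult gr_scale split: if_splits)

lemma single_poly_gr: "mdeg m \<le> d \<Longrightarrow> a \<in> gr (d - mdeg m) \<Longrightarrow> Poly_Mapping.single m a \<in> poly_gr gr d"
  by (auto simp: poly_gr_def lookup_single when_def gr_zero)

lemma poly_gr_mult:
  assumes p: "p \<in> poly_gr gr i" and q: "q \<in> poly_gr gr j"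
  shows "p * q \<in> poly_gr gr (i + j)"
proof -
  let ?s = "\<lambda>p m. Poly_Mapping.single m (Poly_Mapping.lookup p m)"
  have "?s p m * ?s q m' \<in> poly_gr gr (i + j)" for m m'
  proof (cases "mdeg m \<le> i \<and> mdeg m' \<le> j")
    case True
    then have "Poly_Mapping.lookup p m \<in> gr (i - mdeg m)" "Poly_Mapping.lookup q m' \<in> gr (j - mdeg m')"
      using p q unfolding poly_gr_def by (auto split: if_splits dest: spec)
    then have "Poly_Mapping.lookup p m * Poly_Mapping.lookup q m' \<in> gr (i - mdeg m + (j - mdeg m'))"
      by (rule gr_mult)
    moreover have "i - mdeg m + (j - mdeg m') = i + j - mdeg (m + m')"
      using True by (simp add: mdeg_add)
    ultimately show ?thesis
      using True by (auto simp: mult_single mdeg_add intro!: single_poly_gr)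
  next
    case False
    then have "Poly_Mapping.lookup p m = 0 \<or> Poly_Mapping.lookup q m' = 0"
      using p q unfolding poly_gr_def by (auto split: if_splits dest: spec)
    then show ?thesis by (auto simp: poly_gr_zero)
  qed
  then have "(\<Sum>m\<in>Poly_Mapping.keys p. ?s p m) * (\<Sum>m\<in>Poly_Mapping.keys q. ?s q m) \<in> poly_gr gr (i + j)"
    unfolding sum_product by (intro poly_gr_sum)
  then show ?thesis by (simp flip: poly_mapping_sum_singles)
qed

text \<open>\<open>mapp\<close> acts on the support only; the formula nevertheless holds at every
  monomial because \<open>hpart\<close> sends 0 to 0.\<close>

definition poly_hpart :: "nat \<Rightarrow> (('n::finite \<Rightarrow>\<^sub>0 nat) \<Rightarrow>\<^sub>0 'a) \<Rightarrow> ('n \<Rightarrow>\<^sub>0 nat) \<Rightarrow>\<^sub>0 'a" where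
  "poly_hpart d = Poly_Mapping.mapp (\<lambda>m a. if mdeg m \<le> d then hpart (d - mdeg m) a else 0)"

lemma lookup_poly_hpart:
  "Poly_Mapping.lookup (poly_hpart d p) m = (if mdeg m \<le> d then hpart (d - mdeg m) (Poly_Mapping.lookup p m) else 0)"
  by (auto simp: poly_hpart_def lookup_mapp when_def in_keys_iff)

lemma poly_ex1_decomp:
  fixes p :: "('n::finite \<Rightarrow>\<^sub>0 nat) \<Rightarrow>\<^sub>0 'a"
  shows "\<exists>!h. (\<forall>i. h i \<in> poly_gr gr i) \<and> finite {i. h i \<noteq> 0} \<and> p = sum h {i. h i \<noteq> 0}"
proof (rule ex1I[of _ "\<lambda>d. poly_hpart d p"])
  let ?I = "\<lambda>m. {i. hpart i (Poly_Mapping.lookup p m) \<noteq> 0}"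
  let ?F = "{d. poly_hpart d p \<noteq> 0}"
  \<comment> \<open>Finiteness: a nonzero total degree is \<open>i + mdeg m\<close> for a monomial
    \<open>m\<close> of the support and a nonzero component of degree \<open>i\<close> of its
    coefficient.\<close>
  have "?F \<subseteq> (\<Union>m\<in>Poly_Mapping.keys p. (\<lambda>i. i + mdeg m) ` ?I m)"
  proof
    fix d assume "d \<in> ?F"
    then obtain m where "Poly_Mapping.lookup (poly_hpart d p) m \<noteq> 0"
      by (metis (mono_tags) lookup_zero mem_Collect_eq poly_mapping_eqI)
    then have "mdeg m \<le> d" "hpart (d - mdeg m) (Poly_Mapping.lookup p m) \<noteq> 0"
      by (auto simp: lookup_poly_hpart split: if_splits)
    moreover from this have "m \<in> Poly_Mapping.keys p" by (auto simp: in_keys_iff)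
    ultimately show "d \<in> (\<Union>m\<in>Poly_Mapping.keys p. (\<lambda>i. i + mdeg m) ` ?I m)"
      by (intro UN_I[of m] image_eqI[of _ _ "d - mdeg m"]) auto
  qed
  then have fin: "finite ?F" by (rule finite_subset) auto
  have "Poly_Mapping.lookup p m = Poly_Mapping.lookup (\<Sum>d\<in>?F. poly_hpart d p) m" for m
  proof -
    \<comment> \<open>At a fixed monomial, the sum over total degrees is reindexed by the degree
      \<open>i\<close> of the coefficient; the other total degrees contribute zero.\<close>
    have sub: "(\<lambda>i. i + mdeg m) ` ?I m \<subseteq> ?F"
    proof clarify
      fix i assume "hpart i (Poly_Mapping.lookup p m) \<noteq> 0" "poly_hpart (i + mdeg m) p = 0"
      then show False using lookup_poly_hpart[of "i + mdeg m" p m] by simp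
    qed
    have "Poly_Mapping.lookup (\<Sum>d\<in>?F. poly_hpart d p) m =
        (\<Sum>d\<in>?F. if mdeg m \<le> d then hpart (d - mdeg m) (Poly_Mapping.lookup p m) else 0)"
      by (simp add: lookup_sum lookup_poly_hpart)
    also have "\<dots> = (\<Sum>d\<in>(\<lambda>i. i + mdeg m) ` ?I m. if mdeg m \<le> d then hpart (d - mdeg m) (Poly_Mapping.lookup p m) else 0)"
    proof (rule sum.mono_neutral_right[OF fin sub], safe)
      fix d assume d: "d \<notin> (\<lambda>i. i + mdeg m) ` ?I m"
      show "(if mdeg m \<le> d then hpart (d - mdeg m) (Poly_Mapping.lookup p m) else 0) = 0"
      proof (rule ccontr)
        assume "\<not> ?thesis"
        then have "d \<in> (\<lambda>i. i + mdeg m) ` ?I m"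
          by (intro image_eqI[of _ _ "d - mdeg m"]) (auto split: if_splits)
        with d show False by blast
      qed
    qed
    also have "\<dots> = (\<Sum>i\<in>?I m. hpart i (Poly_Mapping.lookup p m))"
      by (subst sum.reindex) (auto simp: inj_on_def)
    also have "\<dots> = Poly_Mapping.lookup p m" by (rule sum_hpart) auto
    finally show ?thesis by simp
  qed
  then have "p = (\<Sum>d\<in>?F. poly_hpart d p)" by (rule poly_mapping_eqI)
  moreover have "poly_hpart d p \<in> poly_gr gr d" for d
    by (auto simp: poly_gr_def lookup_poly_hpart)
  ultimately show "(\<forall>d. poly_hpart d p \<in> poly_gr gr d) \<and> finite ?F \<and> p = (\<Sum>d\<in>?F. poly_hpart d p)"
    using fin by blast
next
  fix h assume h: "(\<forall>i. h i \<in> poly_gr gr i) \<and> finite {i. h i \<noteq> 0} \<and> p = sum h {i. h i \<noteq> 0}"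
  let ?F = "{i. h i \<noteq> 0}"
  \<comment> \<open>The shift by \<open>mdeg m\<close> is injective on degrees at least
    \<open>mdeg m\<close>, so at the monomial \<open>m\<close> only the summand \<open>e = d\<close>
    has a coefficient component of degree \<open>d - mdeg m\<close>.\<close>
  have part: "hpart (d - mdeg m) (Poly_Mapping.lookup (h e) m) = (if e = d then Poly_Mapping.lookup (h d) m else 0)"
    if "mdeg m \<le> d" for d e m
  proof -
    have "Poly_Mapping.lookup (h e) m \<in> (if mdeg m \<le> e then gr (e - mdeg m) else {0})"
      using h unfolding poly_gr_def by blast
    moreover have "d - mdeg m = e - mdeg m \<longleftrightarrow> e = d" if "mdeg m \<le> e"
      using \<open>mdeg m \<le> d\<close> that by linarith
    ultimately show ?thesis using \<open>mdeg m \<le> d\<close>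
      by (cases "mdeg m \<le> e") (simp_all add: hpart_gr)
  qed
  have "Poly_Mapping.lookup (h d) m = Poly_Mapping.lookup (poly_hpart d p) m" for d m
  proof (cases "mdeg m \<le> d")
    case True
    have "p = sum h ?F" using h by blast
    then have "Poly_Mapping.lookup p m = Poly_Mapping.lookup (sum h ?F) m" by (rule arg_cong)
    then have "Poly_Mapping.lookup p m = (\<Sum>e\<in>?F. Poly_Mapping.lookup (h e) m)"
      by (simp only: lookup_sum)
    then have "hpart (d - mdeg m) (Poly_Mapping.lookup p m) = (\<Sum>e\<in>?F. if e = d then Poly_Mapping.lookup (h d) m else 0)"
      by (simp only: hpart_sum part[OF True])
    also have "\<dots> = Poly_Mapping.lookup (h d) m"
      using conjunct1[OF conjunct2[OF h]] by (simp add: sum.delta)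
    finally show ?thesis using True by (simp add: lookup_poly_hpart)
  next
    case False
    have "Poly_Mapping.lookup (h d) m \<in> (if mdeg m \<le> d then gr (d - mdeg m) else {0})"
      using h unfolding poly_gr_def by blast
    with False show ?thesis by (simp add: lookup_poly_hpart)
  qed
  then show "h = (\<lambda>d. poly_hpart d p)" by (intro ext poly_mapping_eqI) 
qed

lemma poly_gr_0: "poly_gr gr 0 = range (poly_iota \<iota> :: _ \<Rightarrow> ('n::finite \<Rightarrow>\<^sub>0 nat) \<Rightarrow>\<^sub>0 'a)"
proof (intro equalityI subsetI)
  fix p :: "('n \<Rightarrow>\<^sub>0 nat) \<Rightarrow>\<^sub>0 'a" assume "p \<in> poly_gr gr 0"
  then have p: "Poly_Mapping.lookup p m \<in> (if mdeg m \<le> 0 then gr (0 - mdeg m) else {0})" for m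
    unfolding poly_gr_def by blast
  obtain c where c: "Poly_Mapping.lookup p 0 = \<iota> c" using p[of 0] by (auto simp: gr_0)
  have "Poly_Mapping.lookup p m = Poly_Mapping.lookup (poly_iota \<iota> c) m" for m
    using p[of m] c by (auto simp: poly_iota_def lookup_single when_def mdeg_eq_0_iff split: if_splits)
  then have "p = poly_iota \<iota> c" by (rule poly_mapping_eqI)
  then show "p \<in> range (poly_iota \<iota>)" by blast
qed (auto simp: poly_iota_def gr_0 intro!: single_poly_gr)

lemma poly_gr_1E:
  fixes p :: "('n::finite \<Rightarrow>\<^sub>0 nat) \<Rightarrow>\<^sub>0 'a"
  assumes "p \<in> poly_gr gr 1"
  obtains c where "Poly_Mapping.lookup p 0 \<in> gr 1"
    "p = const_poly (Poly_Mapping.lookup p 0) + (\<Sum>i\<in>UNIV. poly_iota \<iota> (c i) * var i)"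
proof -
  have p: "Poly_Mapping.lookup p m \<in> (if mdeg m \<le> 1 then gr (1 - mdeg m) else {0})" for m
    using assms unfolding poly_gr_def by blast
  have "\<exists>c. Poly_Mapping.lookup p (Poly_Mapping.single i 1) = \<iota> c" for i
    using p[of "Poly_Mapping.single i 1"] by (auto simp: gr_0)
  then obtain c where c: "\<And>i. Poly_Mapping.lookup p (Poly_Mapping.single i 1) = \<iota> (c i)" by metis
  have "Poly_Mapping.lookup p m =
      Poly_Mapping.lookup (const_poly (Poly_Mapping.lookup p 0) + (\<Sum>i\<in>UNIV. poly_iota \<iota> (c i) * var i)) m" for m
  proof -
    have rhs: "Poly_Mapping.lookup (const_poly (Poly_Mapping.lookup p 0) + (\<Sum>i\<in>UNIV. poly_iota \<iota> (c i) * var i)) m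
        = (Poly_Mapping.lookup p 0 when 0 = m) + (\<Sum>i\<in>UNIV. \<iota> (c i) when Poly_Mapping.single i 1 = m)"
      by (simp add: lookup_add lookup_sum poly_iota_def mult_single lookup_single)
    consider "m = 0" | i where "m = Poly_Mapping.single i 1" | "\<not> mdeg m \<le> 1"
      by (metis mdeg_eq_0_iff mdeg_eq_1_iff le_neq_implies_less less_one)
    then show ?thesis
    proof cases
      case 1
      have "Poly_Mapping.single i (1 :: nat) \<noteq> 0" for i :: 'n
        using mdeg_single[of i 1] by (metis mdeg_zero zero_neq_one)
      then show ?thesis unfolding rhs using 1 by (simp add: when_def)
    next
      case (2 i)
      have "0 \<noteq> m" using 2 mdeg_single[of i 1] by (metis mdeg_zero zero_neq_one)
      moreover have "Poly_Mapping.single j 1 = m \<longleftrightarrow> j = i" for j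
        using 2 by (metis lookup_single_eq lookup_single_not_eq zero_neq_one)
      ultimately show ?thesis unfolding rhs using c[of i] 2 by (simp add: when_def)
    next
      case 3
      then have "0 \<noteq> m" "Poly_Mapping.single i 1 \<noteq> m" for i by auto
      then show ?thesis unfolding rhs using p[of m] 3 by simp
    qed
  qed
  then have "p = const_poly (Poly_Mapping.lookup p 0) + (\<Sum>i\<in>UNIV. poly_iota \<iota> (c i) * var i)"
    by (rule poly_mapping_eqI)
  moreover have "Poly_Mapping.lookup p 0 \<in> gr 1" using p[of 0] by simp
  ultimately show ?thesis using that by blast
qed

lemma const_poly_gr: "a \<in> gr d \<Longrightarrow> const_poly a \<in> poly_gr gr d"
  by (intro single_poly_gr) simp_all

lemma var_poly_gr: "var i \<in> poly_gr gr 1"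
  by (intro single_poly_gr) (auto simp: gr_0 intro: range_eqI[of _ _ 1])

lemma poly_generated: "gen_alg (poly_iota \<iota>) (poly_gr gr 1) = (UNIV :: (('n::finite \<Rightarrow>\<^sub>0 nat) \<Rightarrow>\<^sub>0 'a) set)"
proof -
  let ?G = "gen_alg (poly_iota \<iota>) (poly_gr gr 1) :: (('n \<Rightarrow>\<^sub>0 nat) \<Rightarrow>\<^sub>0 'a) set"
  have const: "const_poly a \<in> ?G" if "a \<in> gen_alg \<iota> (gr 1)" for a
    using that
  proof induction
    case (gen s)
    then show ?case by (intro gen_alg.gen const_poly_gr)
  next
    case (scal c)
    show ?case by (simp only: gen_alg.scal flip: poly_iota_def)
  next
    case (add x y)
    then show ?case using gen_alg.add by (simp add: single_add)
  next
    case (mult x y)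
    then show ?case using gen_alg.mult[of "const_poly x" "poly_iota \<iota>" _ "const_poly y"] by (simp add: mult_single)
  qed
  have "p \<in> ?G" for p
  proof (induction p rule: poly_induct)
    case (const a)
    show ?case using \<open>\<And>a. a \<in> gen_alg \<iota> (gr 1) \<Longrightarrow> const_poly a \<in> ?G\<close> generated by blast
  qed (use var_poly_gr in \<open>blast intro: gen_alg.intros\<close>)+
  then show ?thesis by blast
qed

text \<open>Polynomial extensions thereby satisfy the assumptions of \<open>conn_graded_iso\<close>.
  In degree 1, the constants from a spanning set of \<open>gr 1\<close> together with the variables
  span.\<close>

theorem poly_conn_graded:
  "conn_graded (poly_iota \<iota> :: 'k \<Rightarrow> ('n::finite \<Rightarrow>\<^sub>0 nat) \<Rightarrow>\<^sub>0 'a) (poly_gr gr)"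
proof
  interpret P: central_algebra "poly_iota \<iota> :: 'k \<Rightarrow> ('n::finite \<Rightarrow>\<^sub>0 nat) \<Rightarrow>\<^sub>0 'a"
    by (rule poly_central_algebra)
  obtain S where S: "finite S" "S \<subseteq> gr 1" "gr 1 = vs.span S" using fin_span by blast
  define T where "T = (const_poly ` S \<union> range var :: (('n \<Rightarrow>\<^sub>0 nat) \<Rightarrow>\<^sub>0 'a) set)"
  have T: "finite T" "T \<subseteq> poly_gr gr 1"
    using S(1,2) var_poly_gr const_poly_gr unfolding T_def by auto
  have const: "const_poly a \<in> P.vs.span T" if "a \<in> vs.span S" for a
    using that
  proof (induction rule: vs.span_induct)
    case base
    show ?case
    proof (rule vs.subspaceI; clarify)
      fix c a assume "const_poly a \<in> P.vs.span T"
      then have "poly_iota \<iota> c * const_poly a \<in> P.vs.span T" by (rule P.vs.span_scale)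
      then show "const_poly (\<iota> c * a) \<in> P.vs.span T" by (simp add: poly_iota_def mult_single)
    qed (auto simp: single_add intro: P.vs.span_zero P.vs.span_add)
  next
    case (step a)
    then show ?case by (intro P.vs.span_base) (auto simp: T_def)
  qed
  have "poly_gr gr 1 \<subseteq> P.vs.span T"
  proof
    fix p :: "('n \<Rightarrow>\<^sub>0 nat) \<Rightarrow>\<^sub>0 'a" assume "p \<in> poly_gr gr 1"
    then obtain c where *: "Poly_Mapping.lookup p 0 \<in> gr 1"
      and **: "p = const_poly (Poly_Mapping.lookup p 0) + (\<Sum>i\<in>UNIV. poly_iota \<iota> (c i) * var i)"
      by (rule poly_gr_1E)
    have "const_poly (Poly_Mapping.lookup p 0) \<in> P.vs.span T" using const * S(3) by blast
    moreover have "(\<Sum>i\<in>UNIV. poly_iota \<iota> (c i) * var i) \<in> P.vs.span T"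
      by (intro P.vs.span_sum P.vs.span_scale P.vs.span_base) (auto simp: T_def)
    ultimately show "p \<in> P.vs.span T" by (subst **) (rule P.vs.span_add)
  qed
  moreover have "P.vs.span T \<subseteq> poly_gr gr 1"
    by (rule P.vs.span_minimal[OF T(2)], rule P.vs.subspaceI)
       (auto intro: poly_gr_zero poly_gr_add poly_gr_scale)
  ultimately have "poly_gr gr 1 = P.vs.span T" by blast
  then have fin: "\<exists>S. finite S \<and> S \<subseteq> poly_gr gr 1 \<and> poly_gr gr 1 = k_span (poly_iota \<iota> :: 'k \<Rightarrow> ('n \<Rightarrow>\<^sub>0 nat) \<Rightarrow>\<^sub>0 'a) S"
    using T unfolding P.k_span_eq_span by blast
  show "conn_graded_fg1 (poly_iota \<iota> :: 'k \<Rightarrow> ('n \<Rightarrow>\<^sub>0 nat) \<Rightarrow>\<^sub>0 'a) (poly_gr gr)"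
    unfolding conn_graded_fg1_def
    by (intro conjI P.algebra fin poly_generated poly_gr_0 allI ballI poly_ex1_decomp
          poly_gr_zero poly_gr_add poly_gr_scale poly_gr_mult)
qed

end

subsection \<open>Cancellation\<close>

lemma (in central_algebra) iota_eq_0_iff: "\<iota> c = 0 \<longleftrightarrow> c = 0"
proof
  assume "\<iota> c = 0"
  then have "\<iota> (c * inverse c) = 0" by (simp add: iota_mult)
  then show "c = 0" by (cases "c = 0") auto
qed simp

text \<open>A basis of the affine-linear forms with scalar coefficients. Indexing it by monomials
  shows that its size does not depend on the coefficient ring.\<close>

definition affine_basis :: "(('n \<Rightarrow>\<^sub>0 nat) \<Rightarrow>\<^sub>0 'a::zero_neq_one) set" where
  "affine_basis = monomial ` insert 0 (range (\<lambda>i. Poly_Mapping.single i 1))"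

lemma inj_monomial: "inj (monomial :: ('n \<Rightarrow>\<^sub>0 nat) \<Rightarrow> ('n \<Rightarrow>\<^sub>0 nat) \<Rightarrow>\<^sub>0 'a::zero_neq_one)"
  by (rule injI) (metis lookup_single_eq lookup_single_not_eq zero_neq_one)

lemma finite_affine_basis: "finite (affine_basis :: (('n::finite \<Rightarrow>\<^sub>0 nat) \<Rightarrow>\<^sub>0 'a::zero_neq_one) set)"
  by (simp add: affine_basis_def)

lemma card_affine_basis:
  "card (affine_basis :: (('n::finite \<Rightarrow>\<^sub>0 nat) \<Rightarrow>\<^sub>0 'a::zero_neq_one) set) =
   card (insert 0 (range (\<lambda>i :: 'n. Poly_Mapping.single i (1 :: nat))))"
  unfolding affine_basis_def by (rule card_image) (rule inj_on_subset[OF inj_monomial subset_UNIV])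

lemma one_affine_basis: "(1 :: ('n \<Rightarrow>\<^sub>0 nat) \<Rightarrow>\<^sub>0 'a::ring_1) \<in> affine_basis"
  unfolding affine_basis_def by (rule image_eqI[of _ _ 0]) auto

lemma var_affine_basis: "var i \<in> affine_basis"
  unfolding affine_basis_def by blast

lemma affine_basis_cases:
  assumes "(p :: ('n \<Rightarrow>\<^sub>0 nat) \<Rightarrow>\<^sub>0 'a::ring_1) \<in> affine_basis"
  obtains "p = 1" | i where "p = var i"
  using assms unfolding affine_basis_def by auto

text \<open>Taking the coefficient at \<open>m\<close> is linear, kills all other monomials and is 1
  on \<open>monomial m\<close>.\<close>

lemma (in central_algebra) independent_monomials:
  "\<not> module.dependent (\<lambda>c x. poly_iota \<iota> c * x) ((monomial :: _ \<Rightarrow> ('n \<Rightarrow>\<^sub>0 nat) \<Rightarrow>\<^sub>0 'a) ` M)"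
proof -
  interpret P: central_algebra "poly_iota \<iota> :: 'k \<Rightarrow> ('n \<Rightarrow>\<^sub>0 nat) \<Rightarrow>\<^sub>0 'a"
    by (rule poly_central_algebra)
  show ?thesis
    unfolding P.vs.dependent_def
  proof clarify
    fix m assume "m \<in> M" and m: "monomial m \<in> P.vs.span (monomial ` M - {monomial m})"
    let ?Z = "{p :: ('n \<Rightarrow>\<^sub>0 nat) \<Rightarrow>\<^sub>0 'a. Poly_Mapping.lookup p m = 0}"
    have "P.vs.span (monomial ` M - {monomial m}) \<subseteq> ?Z"
    proof (rule P.vs.span_minimal)
      show "monomial ` M - {monomial m} \<subseteq> ?Z" by (auto simp: lookup_single when_def)
      show "P.vs.subspace ?Z"
        by (rule P.vs.subspaceI) (simp_all add: lookup_add lookup_const_mult poly_iota_def)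
    qed
    with m show False by auto
  qed
qed

text \<open>The coefficients and the point are scalars, so the value never leaves the image of the
  field.\<close>

lemma (in central_algebra) poly_eval_affine:
  fixes x :: "('n::finite \<Rightarrow>\<^sub>0 nat) \<Rightarrow>\<^sub>0 'a"
  assumes "x \<in> module.span (\<lambda>c x. poly_iota \<iota> c * x) affine_basis"
  shows "\<exists>c. poly_eval d x = \<iota> c"
proof -
  interpret P: central_algebra "poly_iota \<iota> :: 'k \<Rightarrow> ('n \<Rightarrow>\<^sub>0 nat) \<Rightarrow>\<^sub>0 'a"
    by (rule poly_central_algebra)
  show ?thesis using assms
  proof (induction rule: P.vs.span_induct)
    case base
    show ?case
    proof (rule P.vs.subspaceI; clarify)
      show "\<exists>c. poly_eval d 0 = \<iota> c" by (rule exI[of _ 0]) simp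
    next
      fix x y :: "('n \<Rightarrow>\<^sub>0 nat) \<Rightarrow>\<^sub>0 'a" and c e
      assume "poly_eval d x = \<iota> c" "poly_eval d y = \<iota> e"
      then show "\<exists>c. poly_eval d (x + y) = \<iota> c"
        by (intro exI[of _ "c + e"]) (simp add: poly_eval_add iota_add)
    next
      fix e c and x :: "('n \<Rightarrow>\<^sub>0 nat) \<Rightarrow>\<^sub>0 'a"
      assume "poly_eval d x = \<iota> c"
      then show "\<exists>c. poly_eval d (poly_iota \<iota> e * x) = \<iota> c"
        by (intro exI[of _ "e * c"]) (simp add: poly_eval_mult iota_mult poly_iota_def)
    qed
  next
    case (step x)
    then show ?case
    proof (cases rule: affine_basis_cases)
      case 1
      then show ?thesis by (intro exI[of _ 1]) (simp flip: single_one)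
    next
      case (2 i)
      then show ?thesis using poly_eval_var[of d i] by blast
    qed
  qed
qed

context conn_graded
begin

text \<open>Write \<open>p\<close> as a scalar plus a degree-one constant \<open>a\<close> plus a
  scalar linear form in the variables. All but \<open>a\<close> is visibly central, so
  \<open>a\<close> is central too and vanishes by \<open>center\<close>.\<close>

lemma central_low_1:
  fixes p :: "('n::finite \<Rightarrow>\<^sub>0 nat) \<Rightarrow>\<^sub>0 'a"
  assumes center: "{x \<in> gr 1. \<forall>y. x * y = y * x} = {0}"
    and p: "p \<in> conn_graded.low (poly_gr gr) 1" "\<And>q. p * q = q * p"
  shows "p \<in> module.span (\<lambda>c x. poly_iota \<iota> c * x) affine_basis"
proof -
  interpret P: conn_graded "poly_iota \<iota> :: 'k \<Rightarrow> ('n \<Rightarrow>\<^sub>0 nat) \<Rightarrow>\<^sub>0 'a" "poly_gr gr"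
    by (rule poly_conn_graded)
  obtain b where b: "P.hpart 0 p = poly_iota \<iota> b" using P.hpart_in[of 0 p] P.gr_0 by blast
  obtain c where c: "Poly_Mapping.lookup (P.hpart 1 p) 0 \<in> gr 1"
    "P.hpart 1 p = const_poly (Poly_Mapping.lookup (P.hpart 1 p) 0) + (\<Sum>i\<in>UNIV. poly_iota \<iota> (c i) * var i)"
    using poly_gr_1E[OF P.hpart_in] by blast
  define a where "a = Poly_Mapping.lookup (P.hpart 1 p) 0"
  let ?l = "poly_iota \<iota> b + (\<Sum>i\<in>UNIV. poly_iota \<iota> (c i) * var i) :: ('n \<Rightarrow>\<^sub>0 nat) \<Rightarrow>\<^sub>0 'a"
  have p_eq: "p = const_poly a + ?l"
  proof -
    have "P.hpart 1 p = const_poly a + (\<Sum>i\<in>UNIV. poly_iota \<iota> (c i) * var i)"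
      using c(2) by (simp only: a_def[symmetric])
    with P.low_1[OF p(1)] b
    have "p = poly_iota \<iota> b + (const_poly a + (\<Sum>i\<in>UNIV. poly_iota \<iota> (c i) * var i))" by (simp only:)
    also have "\<dots> = const_poly a + ?l" by (rule add.left_commute)
    finally show ?thesis .
  qed
  have lin: "(poly_iota \<iota> c * var i) * q = q * (poly_iota \<iota> c * var i)" for c i and q :: "('n \<Rightarrow>\<^sub>0 nat) \<Rightarrow>\<^sub>0 'a"
    using P.iota_central[of c q] var_central[of i q] commutes_mult[of q "poly_iota \<iota> c" "var i"] by simp
  have "?l * q = q * ?l" for q
    by (simp only: distrib_left distrib_right sum_distrib_left sum_distrib_right lin P.iota_central[of b q])
  then have cent: "const_poly a * q = q * const_poly a" for q :: "('n \<Rightarrow>\<^sub>0 nat) \<Rightarrow>\<^sub>0 'a"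
    using p(2)[of q] unfolding p_eq distrib_left distrib_right by simp
  have "a * y = y * a" for y
    using cent[of "const_poly y"] by (simp add: mult_single inj_eq[OF inj_single])
  then have "a = 0" using center c(1) unfolding a_def by blast
  then have "p = poly_iota \<iota> b * 1 + (\<Sum>i\<in>UNIV. poly_iota \<iota> (c i) * var i)" using p_eq by simp
  also have "\<dots> \<in> P.vs.span affine_basis"
    by (intro P.vs.span_add P.vs.span_sum P.vs.span_scale P.vs.span_base one_affine_basis var_affine_basis)
  finally show ?thesis .
qed

end

text \<open>Count dimensions: \<open>G\<close> is injective, and both affine bases have the same finite cardinality.\<close>
lemma affine_basis_subset_image:
  fixes \<iota>A :: "'k::field \<Rightarrow> 'a::ring_1" and \<iota>B :: "'k \<Rightarrow> 'b::ring_1"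
    and G :: "(('n::finite \<Rightarrow>\<^sub>0 nat) \<Rightarrow>\<^sub>0 'b) \<Rightarrow> (('n \<Rightarrow>\<^sub>0 nat) \<Rightarrow>\<^sub>0 'a)"
  assumes "central_algebra \<iota>A" "central_algebra \<iota>B"
    and G: "alg_iso (poly_iota \<iota>B) (poly_iota \<iota>A) G"
    and sub: "G ` affine_basis \<subseteq> module.span (\<lambda>c x. poly_iota \<iota>A c * x) affine_basis"
  shows "affine_basis \<subseteq> G ` module.span (\<lambda>c x. poly_iota \<iota>B c * x) affine_basis"
proof -
  interpret A: central_algebra \<iota>A by fact
  interpret B: central_algebra \<iota>B by fact
  interpret PA: central_algebra "poly_iota \<iota>A :: 'k \<Rightarrow> ('n \<Rightarrow>\<^sub>0 nat) \<Rightarrow>\<^sub>0 'a"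
    by (rule A.poly_central_algebra)
  interpret PB: central_algebra "poly_iota \<iota>B :: 'k \<Rightarrow> ('n \<Rightarrow>\<^sub>0 nat) \<Rightarrow>\<^sub>0 'b"
    by (rule B.poly_central_algebra)
  interpret G: Vector_Spaces.linear "\<lambda>c x. poly_iota \<iota>B c * x" "\<lambda>c x. poly_iota \<iota>A c * x" G
    using G by unfold_locales (simp_all add: alg_iso_def)
  have inj: "inj G" using G by (simp add: alg_iso_def bij_def)
  have ind: "PA.vs.independent (G ` affine_basis)"
    unfolding affine_basis_def
    by (intro G.independent_injective_image B.independent_monomials inj_on_subset[OF inj subset_UNIV])
  \<comment> \<open>Otherwise adjoining \<open>t\<close> to the independent image would give an
    independent set inside the span of \<open>affine_basis\<close> with one element more than
    \<open>affine_basis\<close>.\<close>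
  have "t \<in> PA.vs.span (G ` affine_basis)" if "t \<in> affine_basis" for t
  proof (rule ccontr)
    assume t: "t \<notin> PA.vs.span (G ` affine_basis)"
    then have notin: "t \<notin> G ` affine_basis" using PA.vs.span_base by blast
    have "insert t (G ` affine_basis) \<subseteq> PA.vs.span affine_basis"
      using sub PA.vs.span_base[OF that] by blast
    then have "card (insert t (G ` affine_basis)) \<le> card (affine_basis :: (('n \<Rightarrow>\<^sub>0 nat) \<Rightarrow>\<^sub>0 'a) set)"
      using PA.vs.independent_span_bound[OF finite_affine_basis PA.vs.independent_insertI[OF t ind]] by blast
    also have "\<dots> = card (affine_basis :: (('n \<Rightarrow>\<^sub>0 nat) \<Rightarrow>\<^sub>0 'b) set)" by (simp only: card_affine_basis)
    also have "\<dots> = card (G ` affine_basis)"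
      by (rule card_image[symmetric]) (rule inj_on_subset[OF inj subset_UNIV])
    finally show False using notin by (simp add: finite_affine_basis)
  qed
  then show ?thesis unfolding G.span_image by blast
qed

theorem theorem3p1:
  fixes \<iota>A :: "'k::field \<Rightarrow> 'a::ring_1" and grA :: "nat \<Rightarrow> 'a set"
    and \<iota>B :: "'k \<Rightarrow> 'b::ring_1" and grB :: "nat \<Rightarrow> 'b set"
  assumes A: "conn_graded_fg1 \<iota>A grA"
    and B: "conn_graded_fg1 \<iota>B grB"
    and center: "{x \<in> grA 1. \<forall>y. x * y = y * x} = {0}"
    and iso: "\<exists>f :: (('n::finite \<Rightarrow>\<^sub>0 nat) \<Rightarrow>\<^sub>0 'a) \<Rightarrow> (('n \<Rightarrow>\<^sub>0 nat) \<Rightarrow>\<^sub>0 'b).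
                 alg_iso (poly_iota \<iota>A) (poly_iota \<iota>B) f"
  shows "\<exists>g. alg_iso \<iota>A \<iota>B g"
proof -
  obtain f :: "(('n \<Rightarrow>\<^sub>0 nat) \<Rightarrow>\<^sub>0 'a) \<Rightarrow> (('n \<Rightarrow>\<^sub>0 nat) \<Rightarrow>\<^sub>0 'b)"
    where f: "alg_iso (poly_iota \<iota>A) (poly_iota \<iota>B) f" using iso by blast
  interpret A: conn_graded \<iota>A grA by unfold_locales (rule A)
  interpret B: conn_graded \<iota>B grB by unfold_locales (rule B)
  interpret R: conn_graded "poly_iota \<iota>A :: 'k \<Rightarrow> ('n \<Rightarrow>\<^sub>0 nat) \<Rightarrow>\<^sub>0 'a" "poly_gr grA"
    by (rule A.poly_conn_graded)
  interpret S: conn_graded "poly_iota \<iota>B :: 'k \<Rightarrow> ('n \<Rightarrow>\<^sub>0 nat) \<Rightarrow>\<^sub>0 'b" "poly_gr grB"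
    by (rule B.poly_conn_graded)
  interpret F: conn_graded_iso "poly_iota \<iota>A" "poly_gr grA" "poly_iota \<iota>B" "poly_gr grB" f
    by unfold_locales (rule f)
  define G where "G = F.filt_iso"
  define K where "K = inv G"
  have G: "alg_iso (poly_iota \<iota>B) (poly_iota \<iota>A) G" unfolding G_def by (rule F.alg_iso_filt_iso)
  have G_add: "G (x + y) = G x + G y" and G_mult: "G (x * y) = G x * G y" and G_one: "G 1 = 1"
    for x y
    using G unfolding alg_iso_def by blast+
  have K_add: "K (x + y) = K x + K y" and K_mult: "K (x * y) = K x * K y"
    and K_iota: "K (poly_iota \<iota>A c) = poly_iota \<iota>B c" for x y c
    using alg_iso_inv[OF G] unfolding alg_iso_def K_def by blast+
  have "bij G" using G unfolding alg_iso_def by blast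
  then have GK: "G (K x) = x" and KG: "K (G y) = y" for x y
    by (simp_all add: K_def bij_def surj_f_inv_f)
  have "G s \<in> R.vs.span affine_basis" if "s \<in> affine_basis" for s
    using that
  proof (cases rule: affine_basis_cases)
    case 1
    then show ?thesis by (auto simp: G_one intro: R.vs.span_base one_affine_basis)
  next
    case (2 i)
    \<comment> \<open>Every \<open>q\<close> is \<open>G (K q)\<close>, so \<open>G\<close> carries
      the central variable \<open>s\<close> to a central element.\<close>
    have "G s * q = q * G s" for q
      using G_mult[of s "K q"] G_mult[of "K q" s] var_central[of i "K q"] by (simp add: 2 GK)
    moreover have "G s \<in> R.low 1"
      unfolding G_def 2 by (rule F.filt_iso_low[OF B.var_poly_gr])
    ultimately show ?thesis by (intro A.central_low_1[OF center]) auto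
  qed
  then have G_basis: "G ` affine_basis \<subseteq> R.vs.span affine_basis" by blast
  \<comment> \<open>\<open>K (var i)\<close> is an affine form in the variables over
    \<open>'b\<close>, so its value at the origin is a scalar. These scalars form the point
    \<open>d\<close>.\<close>
  have "\<exists>c. B.poly_eval (\<lambda>_. 0) (K (var i)) = \<iota>B c" for i
  proof -
    have "var i \<in> G ` S.vs.span affine_basis"
      by (rule subsetD[OF affine_basis_subset_image[OF A.central_algebra_axioms B.central_algebra_axioms G G_basis]
            var_affine_basis])
    then obtain x where "x \<in> S.vs.span affine_basis" "var i = G x" by (rule imageE)
    then show ?thesis using B.poly_eval_affine[of x] by (simp only: KG)
  qed
  then obtain d where d: "\<And>i. B.poly_eval (\<lambda>_. 0) (K (var i)) = \<iota>B (d i)" by metis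
  \<comment> \<open>\<open>H\<close> undoes \<open>G\<close> and sets the variables over
    \<open>'b\<close> to zero; \<open>H'\<close> applies \<open>G\<close> and sets the variables
    over \<open>'a\<close> to \<open>d\<close>. Restricted to constants they will be mutually
    inverse.\<close>
  define H where "H p = B.poly_eval (\<lambda>_. 0) (K p)" for p
  define H' where "H' q = A.poly_eval d (G q)" for q
  have H_add: "H (p + q) = H p + H q" and H_mult: "H (p * q) = H p * H q"
    and H_iota: "H (poly_iota \<iota>A c) = \<iota>B c" for p q c
    unfolding H_def by (simp_all add: K_add K_mult K_iota B.poly_eval_add B.poly_eval_mult)
  have H'_add: "H' (p + q) = H' p + H' q" and H'_mult: "H' (p * q) = H' p * H' q" for p q
    unfolding H'_def by (simp_all add: G_add G_mult A.poly_eval_add A.poly_eval_mult)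
  have H_const: "H (const_poly (\<iota>A c)) = \<iota>B c" for c
    using H_iota[of c] by (simp only: poly_iota_def)
  \<comment> \<open>By the choice of \<open>d\<close>, \<open>H\<close> cannot distinguish
    \<open>var i\<close> from \<open>d i\<close>, so it factors through evaluation at
    \<open>d\<close>.\<close>
  have H_var: "H (var i) = H (const_poly (\<iota>A (d i)))" for i
    unfolding H_const using d[of i] by (simp only: H_def)
  have H_eval: "H (const_poly (A.poly_eval d p)) = H p" for p
    by (rule A.hom_factors_through_eval[of H d, OF H_add H_mult H_var])
  \<comment> \<open>\<open>G (var i)\<close> is affine, so its value at \<open>d\<close> is a scalar
    \<open>c\<close>. Since \<open>H\<close> factors through this evaluation, \<open>c\<close> is
    also the value of \<open>var i\<close> at the origin, namely zero. The form
    \<open>\<iota>B 0\<close> matches \<open>hom_factors_through_eval\<close>.\<close>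
  have H'_var: "H' (var i) = H' (const_poly (\<iota>B 0))" for i
  proof -
    have "G (var i) \<in> R.vs.span affine_basis"
      by (rule subsetD[OF G_basis imageI[OF var_affine_basis]])
    then obtain c where c: "A.poly_eval d (G (var i)) = \<iota>A c" using A.poly_eval_affine by blast
    then have "\<iota>B c = H (G (var i))" using H_eval[of "G (var i)"] H_const by metis
    also have "\<dots> = 0" using B.poly_eval_var[of "\<lambda>_. 0" i] by (simp only: H_def KG B.iota_zero)
    finally have "c = 0" by (simp only: B.iota_eq_0_iff)
    then show ?thesis using c H'_add[of 0 0] by (simp add: H'_def)
  qed
  have H'_eval: "H' (const_poly (B.poly_eval (\<lambda>_. 0) q)) = H' q" for q
    by (rule B.hom_factors_through_eval[of H' "\<lambda>_. 0", OF H'_add H'_mult H'_var])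
  \<comment> \<open>The factorization removes the inner evaluation, \<open>G\<close> and
    \<open>K\<close> cancel, and the outer evaluation returns the constant.\<close>
  have "H (const_poly (H' (const_poly b))) = b" for b
    unfolding H'_def H_eval by (simp add: H_def KG)
  moreover have "H' (const_poly (H (const_poly a))) = a" for a
    unfolding H_def H'_eval by (simp add: H'_def GK)
  ultimately have "bij (\<lambda>a. H (const_poly a))"
    by (intro o_bij[of "\<lambda>b. H' (const_poly b)"]) (auto simp: fun_eq_iff)
  moreover have "H (const_poly (a * a')) = H (const_poly a) * H (const_poly a')" for a a'
    using H_mult[of "const_poly a" "const_poly a'"] by (simp add: mult_single)
  moreover have "H (const_poly 1) = 1" using H_const[of 1] by simp
  ultimately have "alg_iso \<iota>A \<iota>B (\<lambda>a. H (const_poly a))"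
    unfolding alg_iso_def by (simp add: single_add H_add H_const)
  then show ?thesis by blast
qed

end
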